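(* Consider a partial differential equation of the form $$z_t-\lambda z_{2t}=A(z,z_1,z_2)\,z_3+B(z,z_1,z_2),\qquad \lambda\in\mathbb{R},\ A^2+B^2\neq 0. \qquad (E)$$ Then (E) describes pseudospherical surfaces ($\delta=1$) or spherical surfaces ($\delta=-1$), with corresponding functions $f_{ij}=f_{ij}(z,z_1,\dots,z_k)$ such that $f_{11}=\eta$ is constant, $f_{21}$ and $f_{31}$ are linear non-homogeneous functions of $z$ and $z_2$ with constant coefficients, $(f_{31,z})^2-\delta (f_{21,z})^2\neq0$ and $\eta=0$, if and only if (up to linear coordinate transformations $x\mapsto ax,\ t\mapsto bt,\ z\mapsto cz+c_0$, $abc\neq0$) it can be written in the form $$z_t-\lambda z_{2t}=D_x^2\left(2\gamma z_1\varphi'\right)-D_x\left((z-\lambda z_2)\varphi\right)-2\delta r^2 z_1\varphi'$$ with $\delta=\pm1$ and associated 1-forms (upper and lower signs chosen consistently) $$\omega_1=-2r z_1\varphi'\,dt,$$ $$\omega_2=\Big(\frac{\sigma}{\gamma}(z-\lambda z_2)\pm r\frac{\sqrt{\gamma+\delta\sigma^2}}{\gamma}\Big)dx+\Big[\sigma D_x(2z_1\varphi')+\Big(-\frac{\sigma}{\gamma}(z-\lambda z_2)\mp r\frac{\sqrt{\gamma+\delta\sigma^2}}{\gamma}\Big)\varphi\Big]dt,$$ $$\omega_3=\pm\Big(\frac{\sqrt{\gamma+\delta\sigma^2}}{\gamma}(z-\lambda z_2)\pm\frac{\delta\sigma r}{\gamma}\Big)dx\pm\Big[\sqrt{\gamma+\delta\sigma^2}\,D_x(2z_1\varphi')+\Big(-\frac{\sqrt{\gamma+\delta\sigma^2}}{\gamma}(z-\lambda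 z_2)\mp\frac{\delta\sigma r}{\gamma}\Big)\varphi\Big]dt,$$ where $\varphi=\varphi(\lambda z_1^2-z^2)$ is a differentiable function (of one variable, evaluated at $\lambda z_1^2-z^2$) such that $\varphi'\neq0$, and $r,\gamma,\sigma\in\mathbb{R}$ with $r\gamma\neq0$ and $\gamma+\delta\sigma^2\geq0$.
   Context: Notation: $z=z(x,t)$ is a real function; $z_i=\partial_x^i z$ ($z_0=z$), $z_t=\partial_t z$, $z_{2t}=\partial_t z_2$. $D_x$, $D_t$ are the total derivatives with respect to $x$ and $t$; on a function $F(z,z_1,\dots,z_m)$, $D_xF=\sum_i z_{i+1}F_{,z_i}$. A subscript $,z$ or $,z_i$ denotes a partial derivative; $\varphi'$ is the derivative of the one-variable function $\varphi$. All functions are differentiable as many times as needed. Inequalities "$\neq0$" for functions are understood generically (on a nonempty open set). Definition. Let $\delta\in\{1,-1\}$. A differential equation $\mathcal{E}$ for $z(x,t)$ describes pseudospherical surfaces (pss) if $\delta=1$, or spherical surfaces (ss) if $\delta=-1$, with corresponding functions $f_{ij}$ ($1\le i\le3$, $1\le j\le2$), if $\mathcal{E}$ is equivalent to (i.e. $z$ solves $\mathcal{E}$ if and only if the following hold) the structure equations $$d\omega_1=\omega_3\wedge\omega_2,\quad d\omega_2=\omega_1\wedge\omega_3,\quad d\omega_3=\delta\,\omega_1\wedge\omega_2$$ of a surface with Gaussian curvature $K=-\delta$, where $\omega_i=f_{i1}dx+f_{i2}dt$ (the associated 1-forms), and $\omega_1\wedge\omega_2\neq0$, i.e. $f_{11}f_{22}-f_{12}f_{21}\neq0$.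 Here $f_{ij}$ are functions of $z$ and finitely many of its $x$-derivatives. Convention on transformations. The class of equations considered and the conditions on the $f_{i1}$ are invariant under linear coordinate transformations $x\mapsto ax$, $t\mapsto bt$, $z\mapsto cz+c_0$ with $a,b,c,c_0\in\mathbb{R}$, $abc\neq0$ (such a transformation may change the value of the constant $\lambda$, and acts on $A$, $B$ and the 1-forms accordingly). The classification is given only up to such transformations. *)

theory Defs
  imports "HOL-Analysis.Analysis"
begin

text \<open>
  A differential function \<open>F(z, z\<^sub>1, ..., z\<^sub>m)\<close> is a function on jets, where a jet \<open>u\<close> lists the
  values \<open>u i = z\<^sub>i\<close>. Domains are open in the product topology of \<open>nat \<Rightarrow> real\<close>; every point of
  such a set has a neighbourhood in it that restricts only finitely many coordinates.
\<close>

type_synonym jet = "nat \<Rightarrow> real"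

definition pd :: "nat \<Rightarrow> (jet \<Rightarrow> real) \<Rightarrow> jet \<Rightarrow> real" where
  "pd i F u = deriv (\<lambda>s. F (u(i := s))) (u i)"

primrec pds :: "nat list \<Rightarrow> (jet \<Rightarrow> real) \<Rightarrow> jet \<Rightarrow> real" where
  "pds [] F = F"
| "pds (i # is) F = pd i (pds is F)"

text \<open>All iterated partial derivatives exist and are continuous. The same notion serves for
  functions of one to three variables by regarding them as functions of the first coordinates.\<close>

definition smooth_jet_on :: "jet set \<Rightarrow> (jet \<Rightarrow> real) \<Rightarrow> bool" where
  "smooth_jet_on V F \<longleftrightarrow>
     (\<forall>is. continuous_on V (pds is F) \<and>
           (\<forall>i. \<forall>u\<in>V. (\<lambda>s. pds is F (u(i := s))) differentiable (at (u i))))"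

definition smooth1_on :: "real set \<Rightarrow> (real \<Rightarrow> real) \<Rightarrow> bool" where
  "smooth1_on I g \<longleftrightarrow> smooth_jet_on {w. w 0 \<in> I} (\<lambda>w. g (w 0))"

definition smooth2_on :: "(real \<times> real) set \<Rightarrow> (real \<Rightarrow> real \<Rightarrow> real) \<Rightarrow> bool" where
  "smooth2_on U z \<longleftrightarrow> smooth_jet_on {w. (w 0, w 1) \<in> U} (\<lambda>w. z (w 0) (w 1))"

definition jets_over :: "(real \<times> real \<times> real) set \<Rightarrow> jet set" where
  "jets_over D = {u. (u 0, u 1, u 2) \<in> D}"

definition smooth3_on :: "(real \<times> real \<times> real) set \<Rightarrow> (real \<Rightarrow> real \<Rightarrow> real \<Rightarrow> real) \<Rightarrow> bool" where
  "smooth3_on D A \<longleftrightarrow> smooth_jet_on (jets_over D) (\<lambda>u. A (u 0) (u 1) (u 2))"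

definition differential_function_on :: "jet set \<Rightarrow> (jet \<Rightarrow> real) \<Rightarrow> bool" where
  "differential_function_on V F \<longleftrightarrow>
     smooth_jet_on V F \<and>
     (\<exists>k. \<forall>u\<in>V. \<forall>v\<in>V. (\<forall>i\<le>k. u i = v i) \<longrightarrow> F u = F v)"

text \<open>\<open>total_deriv F u v\<close> is the sum of \<open>v i * F\<^sub>,\<^sub>z\<^sub>i\<close> at \<open>u\<close>; the index set is finite when \<open>F\<close> is a
  differential function. It is \<open>D\<^sub>x F\<close> for \<open>v i = z\<^sub>i\<^sub>+\<^sub>1\<close> and \<open>D\<^sub>t F\<close> for \<open>v i = z\<^sub>i\<^sub>t\<close>.\<close>

definition total_deriv :: "(jet \<Rightarrow> real) \<Rightarrow> jet \<Rightarrow> jet \<Rightarrow> real" where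
  "total_deriv F u v = (\<Sum>i | pd i F u \<noteq> 0. v i * pd i F u)"

definition Dx :: "(jet \<Rightarrow> real) \<Rightarrow> jet \<Rightarrow> real" where
  "Dx F u = total_deriv F u (\<lambda>i. u (Suc i))"

abbreviation (input) Dt :: "(jet \<Rightarrow> real) \<Rightarrow> jet \<Rightarrow> jet \<Rightarrow> real" where
  "Dt \<equiv> total_deriv"

definition zx :: "(real \<Rightarrow> real \<Rightarrow> real) \<Rightarrow> real \<Rightarrow> real \<Rightarrow> jet" where
  "zx z x t i = (deriv ^^ i) (\<lambda>s. z s t) x"

definition zxt :: "(real \<Rightarrow> real \<Rightarrow> real) \<Rightarrow> real \<Rightarrow> real \<Rightarrow> jet" where
  "zxt z x t i = deriv (\<lambda>s. zx z x s i) t"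

type_synonym equation = "(real \<Rightarrow> real \<Rightarrow> real) \<Rightarrow> real \<Rightarrow> real \<Rightarrow> bool"

definition rhs :: "(real \<Rightarrow> real \<Rightarrow> real \<Rightarrow> real) \<Rightarrow> (real \<Rightarrow> real \<Rightarrow> real \<Rightarrow> real) \<Rightarrow> jet \<Rightarrow> real" where
  "rhs A B u = A (u 0) (u 1) (u 2) * u 3 + B (u 0) (u 1) (u 2)"

definition eqn :: "real \<Rightarrow> (real \<Rightarrow> real \<Rightarrow> real \<Rightarrow> real) \<Rightarrow> (real \<Rightarrow> real \<Rightarrow> real \<Rightarrow> real) \<Rightarrow> equation" where
  "eqn lam A B z x t \<longleftrightarrow> zxt z x t 0 - lam * zxt z x t 2 = rhs A B (zx z x t)"

text \<open>For \<open>\<omega>\<^sub>i = f i 1 dx + f i 2 dt\<close>, the coefficient of \<open>dx \<and> dt\<close> in \<open>\<omega>\<^sub>i \<and> \<omega>\<^sub>j\<close> is \<open>wedge f i j\<close>, and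
  in \<open>d\<omega>\<^sub>i\<close> it is \<open>ext_d f i\<close>.\<close>

definition wedge :: "(nat \<Rightarrow> nat \<Rightarrow> jet \<Rightarrow> real) \<Rightarrow> nat \<Rightarrow> nat \<Rightarrow> jet \<Rightarrow> real" where
  "wedge f i j u = f i 1 u * f j 2 u - f i 2 u * f j 1 u"

definition ext_d :: "(nat \<Rightarrow> nat \<Rightarrow> jet \<Rightarrow> real) \<Rightarrow> nat \<Rightarrow> jet \<Rightarrow> jet \<Rightarrow> real" where
  "ext_d f i u v = Dx (f i 2) u - Dt (f i 1) u v"

definition structure_equations ::
  "real \<Rightarrow> (nat \<Rightarrow> nat \<Rightarrow> jet \<Rightarrow> real) \<Rightarrow> equation" where
  "structure_equations \<delta> f z x t \<longleftrightarrow>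
     (let u = zx z x t; v = zxt z x t in
        ext_d f 1 u v = wedge f 3 2 u \<and>
        ext_d f 2 u v = wedge f 1 3 u \<and>
        ext_d f 3 u v = \<delta> * wedge f 1 2 u)"

text \<open>
  The equation \<open>Eq\<close> describes pseudospherical (\<open>\<delta> = 1\<close>) or spherical (\<open>\<delta> = -1\<close>) surfaces with
  corresponding functions \<open>f i j\<close> on the jet domain \<open>V\<close>. As usual for this notion, the equivalence
  is one of relations between the values of \<open>z\<close> and its derivatives: for every local smooth
  function \<open>z\<close>, the equation holds at a point if and only if the structure equations hold there.
\<close>

definition describes ::
  "real \<Rightarrow> equation \<Rightarrow> (nat \<Rightarrow> nat \<Rightarrow> jet \<Rightarrow> real) \<Rightarrow> jet set \<Rightarrow> bool" where
  "describes \<delta> Eq f V \<longleftrightarrow>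
     (\<forall>i\<in>{1,2,3}. \<forall>j\<in>{1,2}. differential_function_on V (f i j)) \<and>
     (\<forall>u\<in>V. wedge f 1 2 u \<noteq> 0) \<and>
     (\<forall>U z x t. open U \<and> smooth2_on U z \<and> (x, t) \<in> U \<and> zx z x t \<in> V \<longrightarrow>
        (Eq z x t \<longleftrightarrow> structure_equations \<delta> f z x t))"

definition affine_in_z_z2 :: "jet set \<Rightarrow> (jet \<Rightarrow> real) \<Rightarrow> bool" where
  "affine_in_z_z2 V F \<longleftrightarrow> (\<exists>p q s. \<forall>u\<in>V. F u = p * u 0 + q * u 2 + s)"

definition admissible ::
  "real \<Rightarrow> real \<Rightarrow> (nat \<Rightarrow> nat \<Rightarrow> jet \<Rightarrow> real) \<Rightarrow> jet set \<Rightarrow> bool" where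
  "admissible \<delta> \<eta> f V \<longleftrightarrow>
     (\<forall>u\<in>V. f 1 1 u = \<eta>) \<and>
     affine_in_z_z2 V (f 2 1) \<and> affine_in_z_z2 V (f 3 1) \<and>
     (\<forall>u\<in>V. (pd 0 (f 3 1) u)\<^sup>2 - \<delta> * (pd 0 (f 2 1) u)\<^sup>2 \<noteq> 0)"

text \<open>The normal form, as a function of the jet: \<open>phi_arg\<close> is the argument of \<open>\<phi>\<close>, \<open>normal_rhs\<close> the
  right-hand side, and \<open>normal_f\<close> the coefficients of the 1-forms; \<open>\<epsilon>\<close> is the upper (\<open>1\<close>) or
  lower (\<open>-1\<close>) sign.\<close>

definition phi_arg :: "real \<Rightarrow> jet \<Rightarrow> real" where
  "phi_arg lam u = lam * (u 1)\<^sup>2 - (u 0)\<^sup>2"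

definition normal_rhs :: "real \<Rightarrow> real \<Rightarrow> (real \<Rightarrow> real) \<Rightarrow> real \<Rightarrow> real \<Rightarrow> jet \<Rightarrow> real" where
  "normal_rhs \<delta> lam \<phi> r \<gamma> u =
     Dx (Dx (\<lambda>w. 2 * \<gamma> * w 1 * deriv \<phi> (phi_arg lam w))) u
     - Dx (\<lambda>w. (w 0 - lam * w 2) * \<phi> (phi_arg lam w)) u
     - 2 * \<delta> * r\<^sup>2 * u 1 * deriv \<phi> (phi_arg lam u)"

definition normal_f ::
  "real \<Rightarrow> real \<Rightarrow> (real \<Rightarrow> real) \<Rightarrow> real \<Rightarrow> real \<Rightarrow> real \<Rightarrow> real \<Rightarrow> nat \<Rightarrow> nat \<Rightarrow> jet \<Rightarrow> real" where
  "normal_f \<delta> lam \<phi> r \<gamma> \<sigma> \<epsilon> i j u =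
    (let R = sqrt (\<gamma> + \<delta> * \<sigma>\<^sup>2);
         m = u 0 - lam * u 2;
         ph = \<phi> (phi_arg lam u);
         X = Dx (\<lambda>w. 2 * w 1 * deriv \<phi> (phi_arg lam w)) u
     in if (i, j) = (1, 1) then 0
        else if (i, j) = (1, 2) then - 2 * r * u 1 * deriv \<phi> (phi_arg lam u)
        else if (i, j) = (2, 1) then \<sigma> / \<gamma> * m + \<epsilon> * r * (R / \<gamma>)
        else if (i, j) = (2, 2) then \<sigma> * X + (- (\<sigma> / \<gamma>) * m - \<epsilon> * r * (R / \<gamma>)) * ph
        else if (i, j) = (3, 1) then \<epsilon> * (R / \<gamma> * m + \<epsilon> * (\<delta> * \<sigma> * r / \<gamma>))
        else if (i, j) = (3, 2) then \<epsilon> * (R * X + (- (R / \<gamma>) * m - \<epsilon> * (\<delta> * \<sigma> * r / \<gamma>)) * ph)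
        else 0)"

text \<open>
  In the coordinates \<open>x' = a x\<close>, \<open>t' = b t\<close>, \<open>z' = c z + c0\<close> the jet \<open>u\<close> of \<open>z\<close> becomes the jet
  \<open>transf_jet a c c0 u\<close> of \<open>z'\<close>, and \<open>z'\<^sub>t\<^sub>' = (c/b) z\<^sub>t\<close>, \<open>z'\<^sub>2\<^sub>t\<^sub>' = c/(a\<^sup>2 b) z\<^sub>2\<^sub>t\<close>. Hence
  \<open>z\<^sub>t - lam z\<^sub>2\<^sub>t = F\<close> turns into \<open>z'\<^sub>t\<^sub>' - (a\<^sup>2 lam) z'\<^sub>2\<^sub>t\<^sub>' = (c/b) F\<close>. Since \<open>dx' = a dx\<close> and
  \<open>dt' = b dt\<close>, a 1-form \<open>p' dx' + q' dt'\<close> is \<open>a p' dx + b q' dt\<close> in the old coordinates.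
\<close>

definition transf_jet :: "real \<Rightarrow> real \<Rightarrow> real \<Rightarrow> jet \<Rightarrow> jet" where
  "transf_jet a c c0 u i = c * u i / a ^ i + (if i = 0 then c0 else 0)"

definition normal_form_on ::
  "real \<Rightarrow> real \<Rightarrow> (jet \<Rightarrow> real) \<Rightarrow> real \<Rightarrow> real \<Rightarrow> real \<Rightarrow> real \<Rightarrow>
   real set \<Rightarrow> (real \<Rightarrow> real) \<Rightarrow> real \<Rightarrow> real \<Rightarrow> jet set \<Rightarrow> bool" where
  "normal_form_on \<delta> lam F a b c c0 I \<phi> r \<gamma> V \<longleftrightarrow>
     a * b * c \<noteq> 0 \<and> r * \<gamma> \<noteq> 0 \<and>
     open I \<and> smooth1_on I \<phi> \<and> (\<forall>s\<in>I. deriv \<phi> s \<noteq> 0) \<and>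
     (\<forall>u\<in>V. phi_arg (a\<^sup>2 * lam) (transf_jet a c c0 u) \<in> I) \<and>
     (\<forall>u\<in>V. c / b * F u = normal_rhs \<delta> (a\<^sup>2 * lam) \<phi> r \<gamma> (transf_jet a c c0 u))"

definition normal_one_forms_on ::
  "real \<Rightarrow> real \<Rightarrow> (nat \<Rightarrow> nat \<Rightarrow> jet \<Rightarrow> real) \<Rightarrow> real \<Rightarrow> real \<Rightarrow> real \<Rightarrow> real \<Rightarrow>
   (real \<Rightarrow> real) \<Rightarrow> real \<Rightarrow> real \<Rightarrow> real \<Rightarrow> real \<Rightarrow> jet set \<Rightarrow> bool" where
  "normal_one_forms_on \<delta> lam f a b c c0 \<phi> r \<gamma> \<sigma> \<epsilon> V \<longleftrightarrow>
     (\<forall>u\<in>V. \<forall>i\<in>{1,2,3}.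
        f i 1 u = a * normal_f \<delta> (a\<^sup>2 * lam) \<phi> r \<gamma> \<sigma> \<epsilon> i 1 (transf_jet a c c0 u) \<and>
        f i 2 u = b * normal_f \<delta> (a\<^sup>2 * lam) \<phi> r \<gamma> \<sigma> \<epsilon> i 2 (transf_jet a c c0 u))"

end

theory Submission
  imports Defs
begin

text \<open>
  Arbitrary values of finitely many \<open>z\<^sub>i\<close> and \<open>z\<^sub>i\<^sub>t\<close> are attained by a polynomial \<open>z(x, t)\<close>, so
  describing a surface amounts to identities on jets. With \<open>m = z - lam z\<^sub>2\<close> these force
  \<open>f\<^sub>2\<^sub>1 = p m + k\<close>, \<open>f\<^sub>3\<^sub>1 = q m + l\<close>. Put \<open>\<Delta> = q\<^sup>2 - \<delta> p\<^sup>2\<close>, \<open>e = q l - \<delta> p k\<close>, \<open>\<kappa> = q k - p l\<close>,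
  \<open>h = f\<^sub>1\<^sub>2\<close>, \<open>P = q f\<^sub>2\<^sub>2 - p f\<^sub>3\<^sub>2\<close>, \<open>Q = q f\<^sub>3\<^sub>2 - \<delta> p f\<^sub>2\<^sub>2\<close>, \<open>M = \<Delta> m + e\<close>, and let \<open>G\<close> be the right-hand
  side of the equation. The structure equations become
  \<open>\<Delta> D\<^sub>x h = M P - \<kappa> Q\<close>, \<open>D\<^sub>x P = - M h\<close>, \<open>D\<^sub>x Q = \<Delta> G - \<delta> \<kappa> h\<close>.
  Comparing the highest derivatives shows that \<open>h\<close> and \<open>P\<close> depend on \<open>z\<close> and \<open>z\<^sub>1\<close> only, and then the
  coefficients of \<open>z\<^sub>2\<close> in the second equation show that \<open>P\<close> is constant on the curves
  \<open>lam z\<^sub>1\<^sup>2 - (z + e/\<Delta>)\<^sup>2 = const\<close>. So \<open>P\<close> is a function of this expression, \<open>h\<close> is determined by its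
  derivative, \<open>\<kappa> = 0\<close> is impossible, and \<open>Q\<close> and \<open>G\<close> follow; the normal form has \<open>\<phi> = - P/\<kappa>\<close>,
  \<open>\<gamma> = 1/\<Delta>\<close>, \<open>\<sigma> = p/\<Delta>\<close>, \<open>r = \<kappa>/\<Delta>\<close>, and only a translation of \<open>z\<close> by \<open>e/\<Delta>\<close> is needed. Conversely,
  the normal form satisfies the structure equations by direct computation, and it is carried over
  by linear coordinate changes.
\<close>

section \<open>Smooth functions on jet space\<close>

text \<open>A basic open set of the product topology restricts only finitely many coordinates, so
  one radius and one bound on their indices suffice.\<close>

lemma open_jets_contains_box:
  fixes V :: "jet set"
  assumes "open V" "u \<in> V"
  obtains N \<rho> where "\<rho> > 0" "\<And>v. (\<And>i. i < N \<Longrightarrow> \<bar>v i - u i\<bar> < \<rho>) \<Longrightarrow> v \<in> V"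
proof -
  have "openin (product_topology (\<lambda>i::nat. euclidean :: real topology) UNIV) V"
    using assms(1) by (simp add: open_fun_def)
  from product_topology_open_contains_basis[OF this assms(2)]
  have "\<exists>X. u \<in> Pi\<^sub>E UNIV X \<and> (\<forall>i. open (X i)) \<and> finite {i. X i \<noteq> UNIV} \<and> Pi\<^sub>E UNIV X \<subseteq> V"
    by simp
  then obtain X where X: "u \<in> Pi\<^sub>E UNIV X" "\<And>i. open (X i)"
      "finite {i. X i \<noteq> UNIV}" "Pi\<^sub>E UNIV X \<subseteq> V"
    by blast
  have "\<forall>i. \<exists>\<rho>>0. ball (u i) \<rho> \<subseteq> X i"
    using X(1,2) by (meson PiE_mem UNIV_I openE)
  from choice[OF this] obtain e where e': "\<forall>i. e i > 0 \<and> ball (u i) (e i) \<subseteq> X i" ..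
  then have e: "e i > 0" "ball (u i) (e i) \<subseteq> X i" for i by auto
  define S where "S = {i. X i \<noteq> UNIV}"
  \<comment> \<open>The inserted 1 keeps the minimum meaningful when no coordinate is
    restricted.\<close>
  define \<rho> where "\<rho> = Min (insert 1 (e ` S))"
  obtain N where N: "\<forall>i\<in>S. i < N"
    using X(3) finite_nat_set_iff_bounded[of S] unfolding S_def by blast
  show thesis
  proof
    show "\<rho> > 0" using X(3) e(1) by (auto simp: \<rho>_def S_def)
    fix v assume v: "\<And>i. i < N \<Longrightarrow> \<bar>v i - u i\<bar> < \<rho>"
    have "v i \<in> X i" for i
    proof (cases "i \<in> S")
      case True
      then have "\<rho> \<le> e i" using X(3) by (auto simp: \<rho>_def S_def)
      then have "v i \<in> ball (u i) (e i)" using v[OF N[rule_format, OF True]]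
        by (auto simp: dist_real_def)
      then show ?thesis using e(2)[of i] by auto
    qed (auto simp: S_def)
    then show "v \<in> V" using X(4) by (auto simp: PiE_def Pi_def extensional_def)
  qed
qed

section \<open>Continuity and open sets in jet space\<close>

lemma continuous_on_fun_upd [continuous_intros]:
  fixes u :: "'b::topological_space \<Rightarrow> jet"
  assumes "continuous_on S u" "continuous_on S g"
  shows "continuous_on S (\<lambda>x. (u x)(i := g x))"
proof (rule continuous_on_coordinatewise_then_product)
  fix j show "continuous_on S (\<lambda>x. ((u x)(i := g x)) j)"
    using assms by (cases "j = i") (auto intro: continuous_on_product_then_coordinatewise)
qed

lemma continuous_on_coordinate [continuous_intros]:
  "continuous_on S (\<lambda>u::jet. u i)"
  by (rule continuous_on_subset[OF continuous_on_product_coordinates]) simp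

lemma open_slice:
  fixes V :: "jet set"
  assumes "open V" shows "open {s. u(i := s) \<in> V}"
proof -
  have "continuous_on UNIV (\<lambda>s. u(i := s))" by (intro continuous_intros)
  from open_vimage[OF assms this] show ?thesis by (simp add: vimage_def)
qed

lemma open_jet_vimage:
  fixes V :: "jet set" and g :: "jet \<Rightarrow> 'b::topological_space"
  assumes "open V" "continuous_on V g" "open T"
  shows "open {u \<in> V. g u \<in> T}"
  using continuous_open_preimage[OF assms(2,1,3)] by (simp add: vimage_def Int_def)

lemma open_box: "open {v::jet. \<forall>i<N. \<bar>v i - u i\<bar> < \<rho>}"
proof -
  have "open {v::jet. \<bar>v i - u i\<bar> < \<rho>}" for i
    by (intro open_Collect_less continuous_intros)
  then have "open (\<Inter>i\<in>{..<N}. {v::jet. \<bar>v i - u i\<bar> < \<rho>})"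
    by (intro open_INT) auto
  also have "(\<Inter>i\<in>{..<N}. {v::jet. \<bar>v i - u i\<bar> < \<rho>}) = {v::jet. \<forall>i<N. \<bar>v i - u i\<bar> < \<rho>}" by auto
  finally show ?thesis .
qed

section \<open>Partial derivatives and smoothness\<close>

abbreviation has_pd :: "(jet \<Rightarrow> real) \<Rightarrow> nat \<Rightarrow> real \<Rightarrow> jet \<Rightarrow> bool" where
  "has_pd F i d u \<equiv> ((\<lambda>s. F (u(i := s))) has_field_derivative d) (at (u i))"

text \<open>The relation \<open>has_pd\<close> carries existence; \<open>pd\<close> has a value even
  where the partial derivative does not exist.\<close>

lemma has_pd_imp_pd: "has_pd F i d u \<Longrightarrow> pd i F u = d"
  by (simp add: pd_def DERIV_imp_deriv)

lemma has_pd_cong: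
  assumes "open V" "u \<in> V" "\<And>w. w \<in> V \<Longrightarrow> F w = G w" "has_pd F i d u"
  shows "has_pd G i d u"
  using assms(4)
  by (rule has_field_derivative_transform_within_open[where S = "{s. u(i := s) \<in> V}"])
    (use assms open_slice in auto)

lemma pd_cong:
  assumes "open V" "u \<in> V" "\<And>w. w \<in> V \<Longrightarrow> F w = G w"
  shows "pd i F u = pd i G u"
  unfolding pd_def
proof (rule deriv_cong_ev)
  show "\<forall>\<^sub>F s in nhds (u i). F (u(i := s)) = G (u(i := s))"
    using assms open_slice[OF assms(1), of u i] by (auto simp: eventually_nhds)
qed simp

lemma smooth_imp_has_pd:
  assumes "smooth_jet_on V F" "u \<in> V"
  shows "has_pd F i (pd i F u) u"
proof -
  have "(\<lambda>s. pds [] F (u(i := s))) differentiable (at (u i))"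
    using assms unfolding smooth_jet_on_def by blast
  then show ?thesis by (simp add: pd_def DERIV_deriv_iff_real_differentiable)
qed

lemma smooth_imp_continuous: "smooth_jet_on V F \<Longrightarrow> continuous_on V F"
  unfolding smooth_jet_on_def by (metis pds.simps(1))

lemma pds_append: "pds (is @ js) F = pds is (pds js F)"
  by (induction "is") auto

lemma smooth_pd: "smooth_jet_on V F \<Longrightarrow> smooth_jet_on V (pd i F)"
  unfolding smooth_jet_on_def
  using pds_append[of _ "[i]" F] by (metis pds.simps)

lemma smooth_subset: "smooth_jet_on V F \<Longrightarrow> V' \<subseteq> V \<Longrightarrow> smooth_jet_on V' F"
  unfolding smooth_jet_on_def by (meson continuous_on_subset subsetD)

text \<open>A class of functions closed, up to equality on \<open>V\<close>, under partial derivatives is smooth. This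
  replaces formulas for the iterated partial derivatives.\<close>

lemma smooth_coinduct:
  assumes V: "open V" and "C F"
    and step: "\<And>F. C F \<Longrightarrow> continuous_on V F \<and>
           (\<forall>i. \<exists>G. C G \<and> (\<forall>u\<in>V. has_pd F i (G u) u))"
  shows "smooth_jet_on V F"
proof -
  have C: "\<exists>G. C G \<and> (\<forall>u\<in>V. pds is F u = G u)" for "is"
  proof (induction "is")
    case Nil
    show ?case using \<open>C F\<close> by auto
  next
    case (Cons i "is")
    then obtain G where G: "C G" "\<forall>u\<in>V. pds is F u = G u" by blast
    from step[OF G(1)] obtain H where "C H" "\<forall>u\<in>V. has_pd G i (H u) u" by blast
    moreover from this have "\<forall>u\<in>V. pds (i # is) F u = H u"
      using G(2) pd_cong[OF V] has_pd_imp_pd by (metis pds.simps(2))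
    ultimately show ?case by blast
  qed
  show ?thesis
    unfolding smooth_jet_on_def
  proof (intro allI conjI ballI)
    fix "is" i u
    obtain G where G: "C G" "\<forall>u\<in>V. pds is F u = G u" using C by blast
    show "continuous_on V (pds is F)" using G step continuous_on_cong by metis
    assume "u \<in> V"
    obtain H where "\<forall>u\<in>V. has_pd G i (H u) u" using step[OF G(1)] by blast
    then have "has_pd (pds is F) i (H u) u"
      using has_pd_cong[OF V \<open>u \<in> V\<close>, of G "pds is F"] G(2) \<open>u \<in> V\<close> by auto
    then show "(\<lambda>s. pds is F (u(i := s))) differentiable at (u i)"
      using real_differentiable_def by blast
  qed
qed

text \<open>As \<open>V\<close> is open, iterated partial derivatives at its points see only the
  values on \<open>V\<close>. The coinduction class consists of the functions that agree on
  \<open>V\<close> with a smooth one.\<close>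

lemma smooth_cong:
  assumes "open V" and F: "smooth_jet_on V F" and eq: "\<And>u. u \<in> V \<Longrightarrow> F u = G u"
  shows "smooth_jet_on V G"
proof (rule smooth_coinduct[where C = "\<lambda>G. \<exists>F. smooth_jet_on V F \<and> (\<forall>u\<in>V. F u = G u)"])
  show "\<exists>F. smooth_jet_on V F \<and> (\<forall>u\<in>V. F u = G u)" using F eq by blast
  fix H assume "\<exists>F. smooth_jet_on V F \<and> (\<forall>u\<in>V. F u = H u)"
  then obtain F where F: "smooth_jet_on V F" and eq: "\<forall>u\<in>V. F u = H u" by blast
  have "continuous_on V H"
    using smooth_imp_continuous[OF F] continuous_on_cong[of V V F H] eq by simp
  moreover have "has_pd H i (pd i F u) u" if "u \<in> V" for i u
    by (rule has_pd_cong[OF assms(1) that _ smooth_imp_has_pd[OF F that]]) (use eq in blast)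
  ultimately show "continuous_on V H \<and>
       (\<forall>i. \<exists>G. (\<exists>F. smooth_jet_on V F \<and> (\<forall>u\<in>V. F u = G u)) \<and> (\<forall>u\<in>V. has_pd H i (G u) u))"
    using smooth_pd[OF F] by blast
qed (fact assms)

lemma pd_fst: "pd 0 (\<lambda>w. g (w 0)) = (\<lambda>w. deriv g (w 0))"
  by (rule ext) (simp add: pd_def)

lemma smooth1_imp_DERIV:
  assumes "smooth1_on I g" "s \<in> I"
  shows "(g has_field_derivative deriv g s) (at s)"
  using smooth_imp_has_pd[of "{w. w 0 \<in> I}" "\<lambda>w. g (w 0)" "\<lambda>_. s" 0] assms
  by (simp add: smooth1_on_def pd_fst)

lemma smooth1_deriv: "smooth1_on I g \<Longrightarrow> smooth1_on I (deriv g)"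
  using smooth_pd[of "{w. w 0 \<in> I}" "\<lambda>w. g (w 0)" 0] by (simp add: smooth1_on_def pd_fst)

text \<open>A syntactic closure made for \<open>smooth_coinduct\<close>: the sum, product and chain
  rules never lead out of it. The clause \<open>base\<close> admits functions known only to be
  smooth.\<close>

inductive smooth_gen :: "jet set \<Rightarrow> (jet \<Rightarrow> real) \<Rightarrow> bool" for V where
  base: "smooth_jet_on V F \<Longrightarrow> smooth_gen V F"
| const: "smooth_gen V (\<lambda>_. c)"
| coord: "smooth_gen V (\<lambda>u. u i)"
| add: "smooth_gen V F \<Longrightarrow> smooth_gen V G \<Longrightarrow> smooth_gen V (\<lambda>u. F u + G u)"
| mult: "smooth_gen V F \<Longrightarrow> smooth_gen V G \<Longrightarrow> smooth_gen V (\<lambda>u. F u * G u)"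
| comp: "smooth_gen V F \<Longrightarrow> smooth1_on I g \<Longrightarrow> (\<And>u. u \<in> V \<Longrightarrow> F u \<in> I)
    \<Longrightarrow> smooth_gen V (\<lambda>u. g (F u))"

lemma smooth_gen_step:
  assumes "smooth_gen V F"
  shows "continuous_on V F \<and> (\<forall>i. \<exists>G. smooth_gen V G \<and> (\<forall>u\<in>V. has_pd F i (G u) u))"
  using assms
proof induction
  case (base F)
  then show ?case
    using smooth_imp_continuous smooth_imp_has_pd smooth_pd smooth_gen.base by blast
next
  case (const c)
  show ?case
    using smooth_gen.const[of V 0] by auto
next
  case (coord i)
  have "\<exists>G. smooth_gen V G \<and> (\<forall>u\<in>V. has_pd (\<lambda>u. u i) j (G u) u)" for j
    using smooth_gen.const[of V 1] smooth_gen.const[of V 0] by (cases "i = j") force+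
  then show ?case using continuous_on_coordinate by blast
next
  case (add F G)
  have "\<exists>H. smooth_gen V H \<and> (\<forall>u\<in>V. has_pd (\<lambda>u. F u + G u) i (H u) u)" for i
  proof -
    obtain F' G' where "smooth_gen V F'" "smooth_gen V G'"
      "\<forall>u\<in>V. has_pd F i (F' u) u" "\<forall>u\<in>V. has_pd G i (G' u) u"
      using add.IH by meson
    then show ?thesis
      by (intro exI[of _ "\<lambda>u. F' u + G' u"] conjI ballI smooth_gen.add DERIV_add) auto
  qed
  moreover have "continuous_on V (\<lambda>u. F u + G u)"
    using add.IH by (intro continuous_on_add) blast+
  ultimately show ?case by blast
next
  case (mult F G)
  have "\<exists>H. smooth_gen V H \<and> (\<forall>u\<in>V. has_pd (\<lambda>u. F u * G u) i (H u) u)" for i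
  proof -
    obtain F' G' where *: "smooth_gen V F'" "smooth_gen V G'"
      "\<forall>u\<in>V. has_pd F i (F' u) u" "\<forall>u\<in>V. has_pd G i (G' u) u"
      using mult.IH by meson
    have "has_pd (\<lambda>u. F u * G u) i (F' u * G u + G' u * F u) u" if "u \<in> V" for u
      using DERIV_mult[OF *(3)[rule_format, OF that] *(4)[rule_format, OF that]] by simp
    then show ?thesis
      using mult.hyps *(1,2)
      by (intro exI[of _ "\<lambda>u. F' u * G u + G' u * F u"] conjI ballI smooth_gen.add smooth_gen.mult)
  qed
  moreover have "continuous_on V (\<lambda>u. F u * G u)"
    using mult.IH by (intro continuous_on_mult) blast+
  ultimately show ?case by blast
next
  case (comp F I g)
  have gc: "continuous_on I g"
    using smooth1_imp_DERIV[OF comp(2)] DERIV_isCont continuous_at_imp_continuous_on by blast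
  have "\<exists>H. smooth_gen V H \<and> (\<forall>u\<in>V. has_pd (\<lambda>u. g (F u)) i (H u) u)" for i
  proof -
    obtain F' where *: "smooth_gen V F'" "\<forall>u\<in>V. has_pd F i (F' u) u"
      using comp.IH by meson
    have "has_pd (\<lambda>u. g (F u)) i (deriv g (F u) * F' u) u" if "u \<in> V" for u
      using DERIV_chain2[of g _ "\<lambda>s. F (u(i := s))" "u i", OF _ *(2)[rule_format, OF that]]
        smooth1_imp_DERIV[OF comp.hyps(2) comp.hyps(3)[OF that]] by simp
    then show ?thesis
      using comp.hyps *(1)
      by (intro exI[of _ "\<lambda>u. deriv g (F u) * F' u"] conjI ballI
          smooth_gen.mult smooth_gen.comp[OF _ smooth1_deriv])
  qed
  moreover have "continuous_on V (\<lambda>u. g (F u))"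
    using comp gc by (intro continuous_on_compose2[of I g V F]) blast+
  ultimately show ?case by blast
qed

lemma smooth_gen_imp_smooth: "open V \<Longrightarrow> smooth_gen V F \<Longrightarrow> smooth_jet_on V F"
  using smooth_coinduct[of V "smooth_gen V" F] smooth_gen_step by blast

section \<open>Total derivatives\<close>

text \<open>The total derivative along \<open>v\<close> as a relation, for functions with only finitely many nonzero
  partial derivatives; unlike the sum over \<open>{i. pd i F u \<noteq> 0}\<close>, it obeys the usual rules of calculus.\<close>

definition has_td :: "(jet \<Rightarrow> real) \<Rightarrow> jet \<Rightarrow> jet \<Rightarrow> real \<Rightarrow> bool" where
  "has_td F u v d \<longleftrightarrow> (\<exists>g n. (\<forall>i. has_pd F i (g i) u) \<and> (\<forall>i\<ge>n. g i = 0) \<and>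
     d = (\<Sum>i<n. v i * g i))"

lemma sum_shrink_lessThan:
  fixes g :: "nat \<Rightarrow> real"
  assumes "\<And>i. i \<ge> n \<Longrightarrow> g i = 0" "n \<le> m"
  shows "(\<Sum>i<m. v i * g i) = (\<Sum>i<n. v i * g i)"
  by (rule sum.mono_neutral_right) (use assms in auto)

lemma total_deriv_eq_sum:
  assumes "\<And>i. i \<ge> n \<Longrightarrow> pd i F u = 0"
  shows "total_deriv F u v = (\<Sum>i<n. v i * pd i F u)"
  unfolding total_deriv_def
  by (rule sum.mono_neutral_left) (use assms in \<open>auto simp: not_le [symmetric]\<close>)

lemma has_td_imp_total_deriv:
  assumes "has_td F u v d" shows "total_deriv F u v = d"
proof -
  obtain g n where g: "\<forall>i. has_pd F i (g i) u" "\<forall>i\<ge>n. g i = 0" "d = (\<Sum>i<n. v i * g i)"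
    using assms unfolding has_td_def by blast
  then have "pd i F u = g i" for i by (simp add: has_pd_imp_pd)
  with g show ?thesis using total_deriv_eq_sum[of n F u v] by simp
qed

lemma has_td_imp_Dx: "has_td F u (\<lambda>i. u (Suc i)) d \<Longrightarrow> Dx F u = d"
  unfolding Dx_def by (rule has_td_imp_total_deriv)

text \<open>Both summation bounds are raised to their maximum, so that the sum and product rules can
  be proved termwise.\<close>

lemma has_td_obtain2:
  assumes "has_td F u v d" "has_td G u v e"
  obtains f g n where "\<forall>i. has_pd F i (f i) u" "\<forall>i. has_pd G i (g i) u"
    "\<forall>i\<ge>n. f i = 0" "\<forall>i\<ge>n. g i = 0" "d = (\<Sum>i<n. v i * f i)" "e = (\<Sum>i<n. v i * g i)"
proof -
  obtain f m where f: "\<forall>i. has_pd F i (f i) u" "\<forall>i\<ge>m. f i = 0" "d = (\<Sum>i<m. v i * f i)"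
    using assms(1) unfolding has_td_def by blast
  obtain g n where g: "\<forall>i. has_pd G i (g i) u" "\<forall>i\<ge>n. g i = 0" "e = (\<Sum>i<n. v i * g i)"
    using assms(2) unfolding has_td_def by blast
  show thesis
    using that[of f g "max m n"] f g
      sum_shrink_lessThan[of m f "max m n" v] sum_shrink_lessThan[of n g "max m n" v] by simp
qed

lemma has_td_const: "has_td (\<lambda>_. c) u v 0"
  unfolding has_td_def by (rule exI[of _ "\<lambda>_. 0"]) (auto intro: exI[of _ 0])

lemma has_td_coord: "has_td (\<lambda>w. w j) u v (v j)"
  unfolding has_td_def
proof (intro exI conjI allI)
  fix i show "has_pd (\<lambda>w. w j) i (if i = j then 1 else 0) u" by (cases "i = j") auto
  show "v j = (\<Sum>i<Suc j. v i * (if i = j then 1 else 0))"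
    by (simp add: if_distrib[of "\<lambda>x. _ * x"] sum.delta cong: if_cong)
qed auto

lemma has_td_add:
  assumes "has_td F u v d" "has_td G u v e"
  shows "has_td (\<lambda>w. F w + G w) u v (d + e)"
proof -
  obtain f g n where *: "\<forall>i. has_pd F i (f i) u" "\<forall>i. has_pd G i (g i) u"
    "\<forall>i\<ge>n. f i = 0" "\<forall>i\<ge>n. g i = 0" "d = (\<Sum>i<n. v i * f i)" "e = (\<Sum>i<n. v i * g i)"
    using has_td_obtain2[OF assms] .
  show ?thesis unfolding has_td_def
    by (rule exI[of _ "\<lambda>i. f i + g i"], rule exI[of _ n])
      (use * in \<open>auto intro: DERIV_add simp: sum.distrib algebra_simps\<close>)
qed

lemma has_td_mult:
  assumes "has_td F u v d" "has_td G u v e"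
  shows "has_td (\<lambda>w. F w * G w) u v (d * G u + e * F u)"
proof -
  obtain f g n where *: "\<forall>i. has_pd F i (f i) u" "\<forall>i. has_pd G i (g i) u"
    "\<forall>i\<ge>n. f i = 0" "\<forall>i\<ge>n. g i = 0" "d = (\<Sum>i<n. v i * f i)" "e = (\<Sum>i<n. v i * g i)"
    using has_td_obtain2[OF assms] .
  have "has_pd (\<lambda>w. F w * G w) i (f i * G u + g i * F u) u" for i
    using DERIV_mult[OF *(1)[rule_format, of i] *(2)[rule_format, of i]] by simp
  then show ?thesis unfolding has_td_def
    by (intro exI[of _ "\<lambda>i. f i * G u + g i * F u"] exI[of _ n])
      (use * in \<open>auto simp: sum.distrib sum_distrib_left algebra_simps\<close>)
qed

lemma has_td_cmult: "has_td F u v d \<Longrightarrow> has_td (\<lambda>w. c * F w) u v (c * d)"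
  using has_td_mult[OF has_td_const[of c u v], of F d] by (simp add: mult.commute)

lemma has_td_diff:
  assumes "has_td F u v d" "has_td G u v e"
  shows "has_td (\<lambda>w. F w - G w) u v (d - e)"
  using has_td_add[OF assms(1) has_td_cmult[OF assms(2), of "-1"]] by simp

lemma has_td_chain:
  assumes "has_td F u v d" "(g has_field_derivative D) (at (F u))"
  shows "has_td (\<lambda>w. g (F w)) u v (D * d)"
proof -
  obtain f n where *: "\<forall>i. has_pd F i (f i) u" "\<forall>i\<ge>n. f i = 0" "d = (\<Sum>i<n. v i * f i)"
    using assms unfolding has_td_def by blast
  have "has_pd (\<lambda>w. g (F w)) i (D * f i) u" for i
    using DERIV_chain2[of g D "\<lambda>s. F (u(i := s))" "u i", OF _ *(1)[rule_format]] assms(2) by simp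
  then show ?thesis unfolding has_td_def
    by (intro exI[of _ "\<lambda>i. D * f i"] exI[of _ n])
      (use * in \<open>auto simp: sum_distrib_left mult_ac\<close>)
qed

lemma has_td_cong:
  assumes "open V" "u \<in> V" "\<And>w. w \<in> V \<Longrightarrow> F w = G w" "has_td F u v d"
  shows "has_td G u v d"
proof -
  obtain g n where g: "\<forall>i. has_pd F i (g i) u" "\<forall>i\<ge>n. g i = 0" "d = (\<Sum>i<n. v i * g i)"
    using assms(4) unfolding has_td_def by blast
  have "has_pd G i (g i) u" for i
    by (rule has_pd_cong[OF assms(1,2) _ g(1)[rule_format]]) (rule assms(3))
  then show ?thesis unfolding has_td_def using g(2,3) by (intro exI[of _ g] exI[of _ n]) simp
qed

text \<open>Coordinate \<open>i\<close> is scaled by \<open>c / a ^ i\<close> and its successor by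
  one more factor \<open>1 / a\<close>; hence the x-derivative in the old coordinates is
  \<open>a\<close> times the one in the new coordinates.\<close>

lemma has_td_transf_jet:
  assumes "has_td F (transf_jet a c c0 u) (\<lambda>i. transf_jet a c c0 u (Suc i)) d" "a \<noteq> 0"
  shows "has_td (\<lambda>w. F (transf_jet a c c0 w)) u (\<lambda>i. u (Suc i)) (a * d)"
proof -
  define T where "T = transf_jet a c c0"
  obtain f n where *: "\<forall>i. has_pd F i (f i) (T u)" "\<forall>i\<ge>n. f i = 0"
      "d = (\<Sum>i<n. T u (Suc i) * f i)"
    using assms unfolding has_td_def T_def by blast
  have "has_pd (\<lambda>w. F (T w)) i (f i * (c / a ^ i)) u" for i
  proof -
    define k where "k = (if i = 0 then c0 else 0)"
    have "T (u(i := s)) = (T u)(i := c * s / a ^ i + k)" for s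
      by (auto simp: T_def transf_jet_def k_def)
    moreover have "((\<lambda>s. c * s / a ^ i + k) has_field_derivative c / a ^ i) (at (u i))"
      using assms(2) by (auto intro!: derivative_eq_intros)
    moreover have "T u i = c * u i / a ^ i + k"
      by (simp add: T_def transf_jet_def k_def)
    ultimately show ?thesis
      using DERIV_chain2[of "\<lambda>s. F ((T u)(i := s))" "f i"
          "\<lambda>s. c * s / a ^ i + k" "u i" "c / a ^ i" UNIV] *(1)[rule_format, of i] by simp
  qed
  moreover have "a * d = (\<Sum>i<n. u (Suc i) * (f i * (c / a ^ i)))"
    using assms(2) by (auto simp: *(3) sum_distrib_left T_def transf_jet_def intro!: sum.cong)
  ultimately show ?thesis unfolding has_td_def T_def
    using *(2) by (intro exI[of _ "\<lambda>i. f i * (c / a ^ i)"] exI[of _ n]) auto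
qed

section \<open>Functions of finitely many jet coordinates\<close>

definition depends_on :: "jet set \<Rightarrow> nat \<Rightarrow> (jet \<Rightarrow> real) \<Rightarrow> bool" where
  "depends_on V n F \<longleftrightarrow> (\<forall>u\<in>V. \<forall>v\<in>V. (\<forall>i<n. u i = v i) \<longrightarrow> F u = F v)"

lemma depends_onD:
  "depends_on V n F \<Longrightarrow> u \<in> V \<Longrightarrow> v \<in> V \<Longrightarrow> (\<And>i. i < n \<Longrightarrow> u i = v i) \<Longrightarrow> F u = F v"
  unfolding depends_on_def by blast

lemma depends_on_mono: "depends_on V n F \<Longrightarrow> n \<le> m \<Longrightarrow> depends_on V m F"
  unfolding depends_on_def by (meson order_less_le_trans)

lemma depends_on_subset: "depends_on V n F \<Longrightarrow> V' \<subseteq> V \<Longrightarrow> depends_on V' n F"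
  unfolding depends_on_def by blast

lemma depends_on_pd_eq_0:
  assumes "open V" "depends_on V n F" "u \<in> V" "i \<ge> n"
  shows "pd i F u = 0"
proof -
  have "has_pd F i 0 u"
    by (rule has_field_derivative_transform_within_open[where S = "{s. u(i := s) \<in> V}" and f = "\<lambda>_. F u"])
      (use assms open_slice in \<open>auto intro!: depends_onD[OF assms(2)]\<close>)
  then show ?thesis by (rule has_pd_imp_pd)
qed

lemma depends_on_pd:
  assumes "open V" "depends_on V n F"
  shows "depends_on V n (pd i F)"
  unfolding depends_on_def
proof (intro ballI impI)
  fix u v assume uv: "u \<in> V" "v \<in> V" "\<forall>j<n. u j = v j"
  show "pd i F u = pd i F v"
  proof (cases "i < n")
    case True
    \<comment> \<open>Both slices contain the common value \<open>u i = v i\<close>, and the two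
      slice functions agree on the intersection, so their derivatives there coincide.\<close>
    have "open ({s. u(i := s) \<in> V} \<inter> {s. v(i := s) \<in> V})"
      using open_slice[OF assms(1)] by blast
    moreover have "F (u(i := s)) = F (v(i := s))" if "u(i := s) \<in> V" "v(i := s) \<in> V" for s
      using depends_onD[OF assms(2) that] uv(3) by simp
    ultimately have "\<forall>\<^sub>F s in nhds (u i). F (u(i := s)) = F (v(i := s))"
      unfolding eventually_nhds using uv(1,2) uv(3)[rule_format, OF True]
      by (intro exI[of _ "{s. u(i := s) \<in> V} \<inter> {s. v(i := s) \<in> V}"]) (auto simp: fun_upd_idem)
    then show ?thesis unfolding pd_def using uv True by (intro deriv_cong_ev) auto
  next
    case False
    then show ?thesis using depends_on_pd_eq_0[OF assms] uv by simp
  qed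
qed

lemma Dx_eq_sum:
  assumes "open V" "depends_on V n F" "u \<in> V"
  shows "Dx F u = (\<Sum>i<n. u (Suc i) * pd i F u)"
  unfolding Dx_def using depends_on_pd_eq_0[OF assms] by (intro total_deriv_eq_sum) auto

lemma smooth_has_td:
  assumes "open V" "depends_on V n F" "smooth_jet_on V F" "u \<in> V"
  shows "has_td F u v (\<Sum>i<n. v i * pd i F u)"
  unfolding has_td_def
  using smooth_imp_has_pd[OF assms(3,4)] depends_on_pd_eq_0[OF assms(1,2,4)]
  by (intro exI[of _ "\<lambda>i. pd i F u"] exI[of _ n]) auto

lemma smooth_has_Dx:
  assumes "open V" "depends_on V n F" "smooth_jet_on V F" "u \<in> V"
  shows "has_td F u (\<lambda>i. u (Suc i)) (Dx F u)"
  using smooth_has_td[OF assms, of "\<lambda>i. u (Suc i)"] has_td_imp_Dx by metis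

lemma differential_function_on_iff:
  "differential_function_on V F \<longleftrightarrow> smooth_jet_on V F \<and> (\<exists>n. depends_on V n F)"
proof -
  \<comment> \<open>The bound \<open>i \<le> k\<close> of a differential function is the strict
    bound \<open>i < Suc k\<close> of \<open>depends_on\<close>.\<close>
  have k: "(\<forall>u\<in>V. \<forall>v\<in>V. (\<forall>i\<le>k. u i = v i) \<longrightarrow> F u = F v) \<longleftrightarrow> depends_on V (Suc k) F" for k
    unfolding depends_on_def less_Suc_eq_le ..
  have "(\<exists>k. depends_on V (Suc k) F) \<longleftrightarrow> (\<exists>n. depends_on V n F)"
    using depends_on_mono[OF _ le_SucI[OF order_refl]] by blast
  then show ?thesis unfolding differential_function_on_def k by simp
qed

section \<open>The normal form satisfies the structure equations\<close>

lemma smooth_gen_diff: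
  "smooth_gen V F \<Longrightarrow> smooth_gen V G \<Longrightarrow> smooth_gen V (\<lambda>u. F u - G u)"
  using smooth_gen.add[OF _ smooth_gen.mult[OF smooth_gen.const[of V "-1"]], of F G] by simp

lemma smooth_gen_uminus: "smooth_gen V F \<Longrightarrow> smooth_gen V (\<lambda>u. - F u)"
  using smooth_gen.mult[OF smooth_gen.const[of V "-1"], of F] by simp

lemma smooth_gen_power: "smooth_gen V F \<Longrightarrow> smooth_gen V (\<lambda>u. F u ^ n)"
  by (induction n) (simp_all add: smooth_gen.const smooth_gen.mult)

lemma smooth_gen_sum:
  "(\<And>i. i \<in> S \<Longrightarrow> smooth_gen V (F i)) \<Longrightarrow> smooth_gen V (\<lambda>u. \<Sum>i\<in>S. F i u)"
  by (induction S rule: infinite_finite_induct) (simp_all add: smooth_gen.const smooth_gen.add)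

lemmas smooth_gen_intros = smooth_gen.const smooth_gen.coord smooth_gen.add smooth_gen.mult
  smooth_gen_diff smooth_gen_uminus smooth_gen_power smooth_gen_sum

abbreviation (input) shift :: "jet \<Rightarrow> jet" where "shift u \<equiv> \<lambda>i. u (Suc i)"

text \<open>With \<open>m = u 0 - lam * u 2\<close> the derivative is \<open>- 2 * u 1 * m\<close>.
  It contains the same combination \<open>m\<close> as the dx-coefficients of the forms, which is
  what makes this argument of \<phi> the right one.\<close>

lemma has_td_phi_arg:
  "has_td (phi_arg lam) u (shift u) (2 * u 1 * (lam * u 2 - u 0))"
proof -
  have "has_td (\<lambda>w. lam * (w 1 * w 1) - w 0 * w 0) u (shift u)
      (lam * (u (Suc 1) * u 1 + u (Suc 1) * u 1) - (u (Suc 0) * u 0 + u (Suc 0) * u 0))"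
    by (intro has_td_diff has_td_cmult has_td_mult has_td_coord)
  moreover have "(\<lambda>w. lam * (w 1 * w 1) - w 0 * w 0) = phi_arg lam"
    by (auto simp: phi_arg_def power2_eq_square)
  moreover have "lam * (u (Suc 1) * u 1 + u (Suc 1) * u 1) - (u (Suc 0) * u 0 + u (Suc 0) * u 0)
      = 2 * u 1 * (lam * u 2 - u 0)"
    by (simp add: numeral_2_eq_2 algebra_simps)
  ultimately show ?thesis by simp
qed

lemma continuous_on_phi_arg: "continuous_on S (phi_arg lam)"
  unfolding phi_arg_def by (intro continuous_intros)

lemma open_phi_arg_vimage: "open I \<Longrightarrow> open {u. phi_arg lam u \<in> I}"
  using open_vimage[OF _ continuous_on_phi_arg] by (simp add: vimage_def)

lemma has_td_smooth1_phi_arg: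
  assumes "smooth1_on I g" "phi_arg lam u \<in> I"
  shows "has_td (\<lambda>w. g (phi_arg lam w)) u (shift u)
    (deriv g (phi_arg lam u) * (2 * u 1 * (lam * u 2 - u 0)))"
  by (rule has_td_chain[OF has_td_phi_arg smooth1_imp_DERIV[OF assms]])

text \<open>\<open>D\<^sub>x (2 z\<^sub>1 \<phi>')\<close>, written out.\<close>

definition flux_Dx :: "real \<Rightarrow> (real \<Rightarrow> real) \<Rightarrow> jet \<Rightarrow> real" where
  "flux_Dx lam \<phi> u = 2 * u 2 * deriv \<phi> (phi_arg lam u)
     + 2 * u 1 * (deriv (deriv \<phi>) (phi_arg lam u) * (2 * u 1 * (lam * u 2 - u 0)))"

lemma has_td_flux:
  assumes "smooth1_on I \<phi>" "phi_arg lam u \<in> I"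
  shows "has_td (\<lambda>w. 2 * w 1 * deriv \<phi> (phi_arg lam w)) u (shift u) (flux_Dx lam \<phi> u)"
  using has_td_mult[OF has_td_cmult[OF has_td_coord[of 1 u "shift u"], of 2]
      has_td_smooth1_phi_arg[OF smooth1_deriv[OF assms(1)] assms(2)]]
  by (simp add: flux_Dx_def numeral_2_eq_2 algebra_simps)

lemma Dx_flux:
  assumes "smooth1_on I \<phi>" "phi_arg lam u \<in> I"
  shows "Dx (\<lambda>w. 2 * w 1 * deriv \<phi> (phi_arg lam w)) u = flux_Dx lam \<phi> u"
  by (rule has_td_imp_Dx[OF has_td_flux[OF assms]])

text \<open>This third-order expression is never written out: it occurs in the right-hand side and
  in the derivatives of the forms alike. Its existence follows from smoothness.\<close>

lemma has_td_flux_Dx: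
  assumes "open I" "smooth1_on I \<phi>" "phi_arg lam u \<in> I"
  shows "has_td (flux_Dx lam \<phi>) u (shift u) (Dx (flux_Dx lam \<phi>) u)"
proof (rule smooth_has_Dx)
  show "open {u. phi_arg lam u \<in> I}" using assms(1) by (rule open_phi_arg_vimage)
  have *: "smooth_gen {u. phi_arg lam u \<in> I} (phi_arg lam)"
    unfolding phi_arg_def by (intro smooth_gen_intros)
  have "smooth_gen {u. phi_arg lam u \<in> I} (flux_Dx lam \<phi>)"
    unfolding flux_Dx_def
    by (intro smooth_gen_intros smooth_gen.comp[OF *, of I] smooth1_deriv assms) auto
  then show "smooth_jet_on {u. phi_arg lam u \<in> I} (flux_Dx lam \<phi>)"
    using open_phi_arg_vimage[OF assms(1)] by (rule smooth_gen_imp_smooth[rotated])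
  show "depends_on {u. phi_arg lam u \<in> I} 3 (flux_Dx lam \<phi>)"
    by (auto simp: depends_on_def flux_Dx_def phi_arg_def)
qed (use assms in auto)

lemma normal_rhs_eq:
  assumes "open I" "smooth1_on I \<phi>" "phi_arg lam u \<in> I"
    and "has_td (\<lambda>w. (w 0 - lam * w 2) * \<phi> (phi_arg lam w)) u (shift u) d"
  shows "normal_rhs \<delta> lam \<phi> r \<gamma> u =
    \<gamma> * Dx (flux_Dx lam \<phi>) u - d - \<delta> * r\<^sup>2 * (2 * u 1 * deriv \<phi> (phi_arg lam u))"
proof -
  \<comment> \<open>The inner derivative is needed on a neighbourhood of \<open>u\<close>, since it
    is differentiated once more.\<close>
  have "Dx (\<lambda>w. 2 * \<gamma> * w 1 * deriv \<phi> (phi_arg lam w)) w = \<gamma> * flux_Dx lam \<phi> w"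
    if "phi_arg lam w \<in> I" for w
    using has_td_imp_Dx[OF has_td_cmult[OF has_td_flux[OF assms(2) that], of \<gamma>]]
    by (simp add: mult_ac)
  then have "has_td (Dx (\<lambda>w. 2 * \<gamma> * w 1 * deriv \<phi> (phi_arg lam w))) u (shift u)
      (\<gamma> * Dx (flux_Dx lam \<phi>) u)"
    using assms(3)
    by (intro has_td_cong[OF open_phi_arg_vimage[OF assms(1)] _ _ has_td_cmult[OF has_td_flux_Dx[OF assms(1-3)]]])
      auto
  from has_td_imp_Dx[OF this] has_td_imp_Dx[OF assms(4)] show ?thesis
    by (simp add: normal_rhs_def)
qed

text \<open>In this arrangement the dt-coefficients of the second and third form are a multiple of
  the differentiated flux minus \<phi> times the dx-coefficient, which produces the cancellations in
  the wedge products.\<close>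

lemma normal_f_simps:
  fixes \<delta> lam \<phi> r \<gamma> \<sigma> \<epsilon>
  assumes "smooth1_on I \<phi>" "phi_arg lam u \<in> I"
  defines "R \<equiv> sqrt (\<gamma> + \<delta> * \<sigma>\<^sup>2)" and "N \<equiv> normal_f \<delta> lam \<phi> r \<gamma> \<sigma> \<epsilon>"
  shows "N 1 1 u = 0"
    and "N 1 2 u = - r * (2 * u 1 * deriv \<phi> (phi_arg lam u))"
    and "N 2 1 u = \<sigma> / \<gamma> * (u 0 - lam * u 2) + \<epsilon> * r * R / \<gamma>"
    and "N 2 2 u = \<sigma> * flux_Dx lam \<phi> u - N 2 1 u * \<phi> (phi_arg lam u)"
    and "N 3 1 u = \<epsilon> * R / \<gamma> * (u 0 - lam * u 2) + \<epsilon>\<^sup>2 * (\<delta> * \<sigma> * r / \<gamma>)"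
    and "N 3 2 u = \<epsilon> * R * flux_Dx lam \<phi> u - N 3 1 u * \<phi> (phi_arg lam u)"
  using Dx_flux[OF assms(1,2)]
  by (simp_all add: N_def R_def normal_f_def Let_def algebra_simps diff_divide_distrib power2_eq_square)

text \<open>These are the structure equations with \<open>z_t - lam z_2t\<close> replaced by the
  right-hand side; \<sigma>/\<gamma> and \<open>\<epsilon> * R / \<gamma>\<close> are the
  coefficients of \<open>u 0 - lam * u 2\<close> in the two dx-coefficients.\<close>

lemma normal_structure:
  fixes \<delta> lam \<phi> r \<gamma> \<sigma> \<epsilon>
  assumes I: "open I" "smooth1_on I \<phi>" "phi_arg lam u \<in> I"
    and "\<gamma> \<noteq> 0" "\<gamma> + \<delta> * \<sigma>\<^sup>2 \<ge> 0" "\<epsilon> = 1 \<or> \<epsilon> = -1"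
  defines "R \<equiv> sqrt (\<gamma> + \<delta> * \<sigma>\<^sup>2)" and "N \<equiv> normal_f \<delta> lam \<phi> r \<gamma> \<sigma> \<epsilon>"
  shows "has_td (N 1 2) u (shift u) (wedge N 3 2 u)"
    and "has_td (N 2 2) u (shift u) (\<sigma> / \<gamma> * normal_rhs \<delta> lam \<phi> r \<gamma> u + wedge N 1 3 u)"
    and "has_td (N 3 2) u (shift u) (\<epsilon> * R / \<gamma> * normal_rhs \<delta> lam \<phi> r \<gamma> u + \<delta> * wedge N 1 2 u)"
proof -
  define p where "p = \<phi> (phi_arg lam u)"
  define Y where "Y = 2 * u 1 * deriv \<phi> (phi_arg lam u)"
  define X where "X = flux_Dx lam \<phi> u"
  define m where "m = u 0 - lam * u 2"
  have R: "R\<^sup>2 = \<gamma> + \<delta> * \<sigma>\<^sup>2" using assms(5) by (simp add: R_def)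
  have e: "\<epsilon>\<^sup>2 = 1" using assms(6) by auto
  define V where "V = {u. phi_arg lam u \<in> I}"
  have V: "open V" "u \<in> V" using I open_phi_arg_vimage by (auto simp: V_def)
  note N = normal_f_simps[OF I(2), of lam _ \<delta> r \<gamma> \<sigma> \<epsilon>, folded N_def R_def]
  have N12: "N 1 2 u = - r * Y" and N21: "N 2 1 u = \<sigma> / \<gamma> * m + \<epsilon> * r * R / \<gamma>"
    and N31: "N 3 1 u = \<epsilon> * R / \<gamma> * m + \<delta> * \<sigma> * r / \<gamma>"
    and N22: "N 2 2 u = \<sigma> * X - N 2 1 u * p" and N32: "N 3 2 u = \<epsilon> * R * X - N 3 1 u * p"
    using N[OF I(3)] e by (simp_all add: m_def X_def p_def Y_def)
  have phi: "has_td (\<lambda>w. \<phi> (phi_arg lam w)) u (shift u) (- Y * m)"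
    using has_td_smooth1_phi_arg[OF I(2,3)] by (simp add: Y_def m_def algebra_simps)
  \<comment> \<open>The derivative \<open>M\<close> of \<open>m\<close> times \<phi> stays
    unevaluated, because it enters the right-hand side and the forms with matching
    coefficients.\<close>
  obtain M where M: "has_td (\<lambda>w. (w 0 - lam * w 2) * \<phi> (phi_arg lam w)) u (shift u) M"
    using has_td_mult[OF has_td_diff[OF has_td_coord[of 0 u "shift u"]
        has_td_cmult[OF has_td_coord[of 2 u "shift u"], of lam]] phi] by blast
  have G: "normal_rhs \<delta> lam \<phi> r \<gamma> u = \<gamma> * Dx (flux_Dx lam \<phi>) u - M - \<delta> * r\<^sup>2 * Y"
    using normal_rhs_eq[OF I M] by (simp add: Y_def)
  \<comment> \<open>Both remaining dt-coefficients have this shape, for different constants.\<close>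
  have td: "has_td (\<lambda>w. k * flux_Dx lam \<phi> w - (k' * ((w 0 - lam * w 2) * \<phi> (phi_arg lam w))
        + k'' * \<phi> (phi_arg lam w))) u (shift u)
      (k * Dx (flux_Dx lam \<phi>) u - (k' * M + k'' * (- Y * m)))" for k k' k''
    by (intro has_td_diff has_td_add has_td_cmult has_td_flux_Dx[OF I] M phi)
  have "has_td (N 1 2) u (shift u) (- r * X)"
    unfolding X_def
    by (rule has_td_cong[OF V _ has_td_cmult[OF has_td_flux[OF I(2,3)]]])
      (simp add: N V_def del: One_nat_def)
  \<comment> \<open>The terms with \<phi> cancel here, those with \<open>m\<close> in the next step;
    the rest is settled by
    \<open>R\<^sup>2 - \<delta> * \<sigma>\<^sup>2 = \<gamma>\<close>.\<close>
  moreover have "wedge N 3 2 u = X * (\<sigma> * N 3 1 u - \<epsilon> * R * N 2 1 u)"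
    by (simp add: wedge_def N22 N32 algebra_simps del: One_nat_def)
  moreover have "\<dots> = X * r * (\<delta> * \<sigma>\<^sup>2 - \<epsilon>\<^sup>2 * R\<^sup>2) / \<gamma>"
    by (simp add: N21 N31 algebra_simps diff_divide_distrib power2_eq_square del: One_nat_def)
  moreover have "\<dots> = - r * X" using assms(4) by (simp add: R e field_simps)
  ultimately show "has_td (N 1 2) u (shift u) (wedge N 3 2 u)" by simp
  have "has_td (N 2 2) u (shift u)
     (\<sigma> * Dx (flux_Dx lam \<phi>) u - (\<sigma> / \<gamma> * M + \<epsilon> * r * R / \<gamma> * (- Y * m)))"
    by (rule has_td_cong[OF V _ td]) (simp add: N V_def algebra_simps del: One_nat_def)
  moreover have "\<sigma> / \<gamma> * normal_rhs \<delta> lam \<phi> r \<gamma> u + wedge N 1 3 u =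
     \<sigma> * Dx (flux_Dx lam \<phi>) u - (\<sigma> / \<gamma> * M + \<epsilon> * r * R / \<gamma> * (- Y * m))"
    using assms(4) N(1)[OF I(3)]
    by (simp add: wedge_def G N12 N31 del: One_nat_def) (simp add: field_simps power2_eq_square)
  ultimately show "has_td (N 2 2) u (shift u) (\<sigma> / \<gamma> * normal_rhs \<delta> lam \<phi> r \<gamma> u + wedge N 1 3 u)"
    by simp
  have "has_td (N 3 2) u (shift u)
     (\<epsilon> * R * Dx (flux_Dx lam \<phi>) u - (\<epsilon> * R / \<gamma> * M + \<delta> * \<sigma> * r / \<gamma> * (- Y * m)))"
    by (rule has_td_cong[OF V _ td]) (simp add: N V_def e algebra_simps del: One_nat_def)
  moreover have "\<epsilon> * R / \<gamma> * normal_rhs \<delta> lam \<phi> r \<gamma> u + \<delta> * wedge N 1 2 u =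
     \<epsilon> * R * Dx (flux_Dx lam \<phi>) u - (\<epsilon> * R / \<gamma> * M + \<delta> * \<sigma> * r / \<gamma> * (- Y * m))"
    using assms(4) N(1)[OF I(3)]
    by (simp add: wedge_def G N12 N21 del: One_nat_def) (simp add: field_simps power2_eq_square)
  ultimately show "has_td (N 3 2) u (shift u) (\<epsilon> * R / \<gamma> * normal_rhs \<delta> lam \<phi> r \<gamma> u + \<delta> * wedge N 1 2 u)"
    by simp
qed

text \<open>The first structure equation holds identically, and the other two reduce to
  \<open>p\<close> and \<open>q\<close> times the differential equation. Since one of these
  constants is nonzero, the equivalence is pointwise.\<close>

lemma structure_equations_iff:
  fixes f F lam \<delta> p q
  assumes "open V" "zx z x t \<in> V" and pq: "p \<noteq> 0 \<or> q \<noteq> 0"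
    and f11: "\<And>u. u \<in> V \<Longrightarrow> f 1 1 u = 0"
    and f21: "\<And>u. u \<in> V \<Longrightarrow> f 2 1 u = p * (u 0 - lam * u 2) + k"
    and f31: "\<And>u. u \<in> V \<Longrightarrow> f 3 1 u = q * (u 0 - lam * u 2) + l"
    and "\<And>u. u \<in> V \<Longrightarrow> has_td (f 1 2) u (shift u) (wedge f 3 2 u)"
    and "\<And>u. u \<in> V \<Longrightarrow> has_td (f 2 2) u (shift u) (p * F u + wedge f 1 3 u)"
    and "\<And>u. u \<in> V \<Longrightarrow> has_td (f 3 2) u (shift u) (q * F u + \<delta> * wedge f 1 2 u)"
  shows "structure_equations \<delta> f z x t \<longleftrightarrow> zxt z x t 0 - lam * zxt z x t 2 = F (zx z x t)"
proof -
  define u v where "u = zx z x t" and "v = zxt z x t"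
  have u: "u \<in> V" using assms by (simp add: u_def)
  have aff: "has_td g u v (p * (v 0 - lam * v 2))"
    if "\<And>u. u \<in> V \<Longrightarrow> g u = p * (u 0 - lam * u 2) + k" for g p k
  proof -
    have "has_td (\<lambda>u. p * (u 0 - lam * u 2) + k) u v (p * (v 0 - lam * v 2) + 0)"
      by (intro has_td_add has_td_cmult has_td_diff has_td_coord has_td_const)
    then show ?thesis
      using has_td_cong[OF assms(1) u, of "\<lambda>u. p * (u 0 - lam * u 2) + k" g] that by simp
  qed
  have "total_deriv (f 1 1) u v = 0" "total_deriv (f 2 1) u v = p * (v 0 - lam * v 2)"
    "total_deriv (f 3 1) u v = q * (v 0 - lam * v 2)"
    using has_td_imp_total_deriv[OF aff[of "f 1 1" 0 0]] has_td_imp_total_deriv[OF aff[of "f 2 1" p k]]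
      has_td_imp_total_deriv[OF aff[of "f 3 1" q l]] f11 f21 f31 by simp_all
  moreover have "Dx (f 1 2) u = wedge f 3 2 u" "Dx (f 2 2) u = p * F u + wedge f 1 3 u"
     "Dx (f 3 2) u = q * F u + \<delta> * wedge f 1 2 u"
    using assms(7-9)[OF u] by (simp_all add: has_td_imp_Dx)
  ultimately have "structure_equations \<delta> f z x t \<longleftrightarrow>
     p * F u = p * (v 0 - lam * v 2) \<and> q * F u = q * (v 0 - lam * v 2)"
    by (auto simp: structure_equations_def Let_def ext_d_def u_def v_def)
  then show ?thesis using pq by (auto simp: u_def v_def)
qed

text \<open>A nonempty open slice of the real line is infinite. This serves both to leave
  exceptional values and to vary a single coordinate.\<close>

lemma open_jet_avoid:
  fixes V :: "jet set"
  assumes "open V" "u \<in> V" "finite S"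
  obtains s where "u(i := s) \<in> V" "s \<notin> S"
proof -
  have "u i \<in> {s. u(i := s) \<in> V}" using assms(2) by simp
  then have "infinite {s. u(i := s) \<in> V}"
    using open_slice[OF assms(1), of u i] finite_imp_not_open by blast
  then have "\<not> {s. u(i := s) \<in> V} \<subseteq> S" using assms(3) infinite_super by blast
  then show thesis using that by blast
qed

section \<open>The normal form under linear coordinate changes\<close>

lemma differential_function_on_cong:
  assumes "open V" "smooth_gen V G" "depends_on V n G" "\<And>u. u \<in> V \<Longrightarrow> G u = F u"
  shows "differential_function_on V F"
proof -
  have "smooth_jet_on V F"
    using smooth_cong[OF assms(1) smooth_gen_imp_smooth[OF assms(1,2)]] assms(4) by blast
  moreover have "depends_on V n F"
    using assms(3,4) unfolding depends_on_def by metis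
  ultimately show ?thesis by (auto simp: differential_function_on_iff)
qed

text \<open>The identities of \<open>normal_structure\<close> are pulled back along
  \<open>transf_jet\<close>. As \<open>f 1 1 = 0\<close>, nondegeneracy means that
  \<open>f 1 2\<close> and \<open>f 2 1\<close> do not vanish, and the domain is shrunk
  accordingly.\<close>

lemma normal_form_imp_describes:
  fixes \<delta> lam a b c c0 \<phi> r \<gamma> \<sigma> \<epsilon>
  assumes V: "open V" "V \<noteq> {}"
    and nf: "normal_form_on \<delta> lam F a b c c0 I \<phi> r \<gamma> V"
    and nof: "normal_one_forms_on \<delta> lam f a b c c0 \<phi> r \<gamma> \<sigma> \<epsilon> V"
    and R0: "\<gamma> + \<delta> * \<sigma>\<^sup>2 \<ge> 0" and eps: "\<epsilon> = 1 \<or> \<epsilon> = -1"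
    and Eq: "\<And>z x t. Eq z x t \<longleftrightarrow> zxt z x t 0 - lam * zxt z x t 2 = F (zx z x t)"
  obtains V' where "open V'" "V' \<noteq> {}" "V' \<subseteq> V" "describes \<delta> Eq f V'" "admissible \<delta> 0 f V'"
proof -
  define T where "T = transf_jet a c c0"
  define R where "R = sqrt (\<gamma> + \<delta> * \<sigma>\<^sup>2)"
  define N where "N = normal_f \<delta> (a\<^sup>2 * lam) \<phi> r \<gamma> \<sigma> \<epsilon>"
  define p where "p = a * c * (\<sigma> / \<gamma>)"
  define k where "k = a * (\<sigma> / \<gamma> * c0 + \<epsilon> * r * R / \<gamma>)"
  define q where "q = a * c * (\<epsilon> * R / \<gamma>)"
  define l where "l = a * (\<epsilon> * R / \<gamma> * c0 + \<delta> * \<sigma> * r / \<gamma>)"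
  have nz: "a \<noteq> 0" "b \<noteq> 0" "c \<noteq> 0" "r \<noteq> 0" "\<gamma> \<noteq> 0" and I: "open I" "smooth1_on I \<phi>"
    and dphi: "\<And>s. s \<in> I \<Longrightarrow> deriv \<phi> s \<noteq> 0"
    and argI: "\<And>u. u \<in> V \<Longrightarrow> phi_arg (a\<^sup>2 * lam) (T u) \<in> I"
    and F: "\<And>u. u \<in> V \<Longrightarrow> c / b * F u = normal_rhs \<delta> (a\<^sup>2 * lam) \<phi> r \<gamma> (T u)"
    using nf by (auto simp: normal_form_on_def T_def)
  have R: "R\<^sup>2 = \<gamma> + \<delta> * \<sigma>\<^sup>2" using R0 by (simp add: R_def)
  have e: "\<epsilon>\<^sup>2 = 1" using eps by auto
  have f: "f i 1 u = a * N i 1 (T u)" "f i 2 u = b * N i 2 (T u)" if "u \<in> V" "i \<in> {1, 2, 3}" for u i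
    using nof that unfolding normal_one_forms_on_def N_def T_def by blast+
  note N = normal_f_simps[OF I(2) argI, of _ \<delta> r \<gamma> \<sigma> \<epsilon>, folded N_def R_def]
  have T: "T u 0 - a\<^sup>2 * lam * T u 2 = c * (u 0 - lam * u 2) + c0" "T u 1 = c * u 1 / a" for u
    using nz(1) by (simp_all add: T_def transf_jet_def field_simps)
  have f11: "f 1 1 u = 0" if "u \<in> V" for u
    using f(1)[OF that, of 1] N(1)[OF that] by simp
  have f21: "f 2 1 u = p * (u 0 - lam * u 2) + k" if "u \<in> V" for u
  proof -
    have "f 2 1 u = a * (\<sigma> / \<gamma> * (c * (u 0 - lam * u 2) + c0) + \<epsilon> * r * R / \<gamma>)"
      using f(1)[OF that, of 2] N(3)[OF that] unfolding T by simp
    then show ?thesis by (simp only: p_def k_def) (simp add: algebra_simps diff_divide_distrib add_divide_distrib)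
  qed
  have f31: "f 3 1 u = q * (u 0 - lam * u 2) + l" if "u \<in> V" for u
  proof -
    have "f 3 1 u = a * (\<epsilon> * R / \<gamma> * (c * (u 0 - lam * u 2) + c0) + \<delta> * \<sigma> * r / \<gamma>)"
      using f(1)[OF that, of 3] N(5)[OF that] unfolding T e by simp
    then show ?thesis by (simp only: q_def l_def) (simp add: algebra_simps diff_divide_distrib add_divide_distrib)
  qed
  \<comment> \<open>The definition of \<open>R\<close> collapses the discriminant to a nonzero
    constant.\<close>
  have disc: "q\<^sup>2 - \<delta> * p\<^sup>2 = a\<^sup>2 * c\<^sup>2 / \<gamma>"
  proof -
    have "q\<^sup>2 - \<delta> * p\<^sup>2 = a\<^sup>2 * c\<^sup>2 * (\<epsilon>\<^sup>2 * R\<^sup>2 - \<delta> * \<sigma>\<^sup>2) / \<gamma>\<^sup>2"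
      by (simp add: p_def q_def power_mult_distrib power_divide algebra_simps diff_divide_distrib)
    also have "\<dots> = a\<^sup>2 * c\<^sup>2 * \<gamma> / \<gamma>\<^sup>2" by (simp add: e R)
    finally show ?thesis using nz by (simp add: power2_eq_square)
  qed
  then have disc0: "q\<^sup>2 - \<delta> * p\<^sup>2 \<noteq> 0" using nz by simp
  then have pq: "p \<noteq> 0 \<or> q \<noteq> 0" by auto
  \<comment> \<open>If \<open>p = 0\<close> then \<open>\<sigma> = 0\<close> and
    \<open>R\<^sup>2 = \<gamma>\<close> is nonzero, so the constant \<open>f 2 1\<close> is nonzero
    too.\<close>
  have pk: "k \<noteq> 0" if "p = 0"
  proof -
    have "\<sigma> = 0" using that nz by (simp add: p_def)
    then show ?thesis using R nz e eps by (auto simp: k_def)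
  qed
  define V' where "V' = {u \<in> V. u 1 * (p * (u 0 - lam * u 2) + k) \<in> - {0}}"
  have V'sub: "V' \<subseteq> V" by (auto simp: V'_def)
  have V'o: "open V'" unfolding V'_def
    by (rule open_jet_vimage[OF V(1)]) (auto intro!: continuous_intros)
  obtain u where "u \<in> V" using V(2) by blast
  then obtain s where s: "u(1 := s) \<in> V" "s \<notin> {0}" using open_jet_avoid[OF V(1), of u "{0}" 1] by blast
  define w where "w = u(1 := s)"
  \<comment> \<open>The avoided value is the zero of \<open>f 2 1\<close> in the coordinate 0. For
    \<open>p = 0\<close> the quotient is 0 by convention and excluding the value is
    harmless.\<close>
  obtain s' where s': "w(0 := s') \<in> V" "s' \<notin> {lam * w 2 - k / p}"
    using open_jet_avoid[OF V(1), of w "{lam * w 2 - k / p}" 0] s by (auto simp: w_def)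
  have "p * (s' - lam * w 2) + k \<noteq> 0"
    using s' pk by (cases "p = 0") (auto simp: field_simps)
  then have "w(0 := s') \<in> V'" using s s' by (auto simp: V'_def w_def)
  then have V'ne: "V' \<noteq> {}" by blast
  have S: "has_td (\<lambda>w. b * N i 2 (T w)) u (shift u) (b * (a * d))"
    if "has_td (N i 2) (T u) (shift (T u)) d" for i u d
    using has_td_cmult[OF has_td_transf_jet[OF that[unfolded T_def] nz(1)]] by (simp add: T_def)
  have S: "has_td (f i 2) u (shift u) (b * (a * d))"
    if "has_td (N i 2) (T u) (shift (T u)) d" "i \<in> {1,2,3}" "u \<in> V" for i u d
    by (rule has_td_cong[OF V(1) that(3) _ S[OF that(1)]]) (use f that in auto)
  note NS = normal_structure[where r = r, OF I argI nz(5) R0 eps, folded N_def R_def]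
  \<comment> \<open>Both sides of a structure equation scale by \<open>a * b\<close>: the derivative
    gets \<open>b\<close> from the dt-coefficient and \<open>a\<close> from the change of x.\<close>
  have W: "wedge f i j u = a * b * wedge N i j (T u)"
    if "u \<in> V" "i \<in> {1,2,3}" "j \<in> {1,2,3}" for u i j
    using f[OF that(1,2)] f[OF that(1,3)] by (simp add: wedge_def algebra_simps)
  have S1: "has_td (f 1 2) u (shift u) (wedge f 3 2 u)" if "u \<in> V" for u
    using S[OF NS(1)[OF that]] W[OF that] that by (simp add: mult_ac)
  have S2: "has_td (f 2 2) u (shift u) (p * F u + wedge f 1 3 u)" if "u \<in> V" for u
  proof -
    have "b * (a * (\<sigma> / \<gamma> * normal_rhs \<delta> (a\<^sup>2 * lam) \<phi> r \<gamma> (T u) + wedge N 1 3 (T u)))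
      = p * F u + wedge f 1 3 u"
      unfolding F[OF that, symmetric] p_def using nz(2) W[OF that, of 1 3] by (simp add: field_simps)
    then show ?thesis using S[OF NS(2)[OF that]] that by simp
  qed
  have S3: "has_td (f 3 2) u (shift u) (q * F u + \<delta> * wedge f 1 2 u)" if "u \<in> V" for u
  proof -
    have "b * (a * (\<epsilon> * R / \<gamma> * normal_rhs \<delta> (a\<^sup>2 * lam) \<phi> r \<gamma> (T u) + \<delta> * wedge N 1 2 (T u)))
      = q * F u + \<delta> * wedge f 1 2 u"
      unfolding F[OF that, symmetric] q_def using nz(2) W[OF that, of 1 2] by (simp add: field_simps)
    then show ?thesis using S[OF NS(3)[OF that]] that by simp
  qed
  have w12: "wedge f 1 2 u \<noteq> 0" if "u \<in> V'" for u
  proof -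
    have u: "u \<in> V" "u 1 \<noteq> 0" "f 2 1 u \<noteq> 0" using that f21 by (auto simp: V'_def)
    have "f 1 2 u \<noteq> 0"
      using f(2)[OF u(1), of 1] N(2)[OF u(1)] nz u(2) dphi[OF argI[OF u(1)]] T(2)[of u]
      by (simp del: One_nat_def)
    then show ?thesis using u f11[OF u(1)] by (simp add: wedge_def)
  qed
  have Tsg: "smooth_gen V (\<lambda>u. T u i)" for i
    unfolding T_def transf_jet_def divide_inverse by (intro smooth_gen_intros)
  have argsg: "smooth_gen V (\<lambda>u. phi_arg (a\<^sup>2 * lam) (T u))"
    unfolding phi_arg_def by (intro smooth_gen_intros Tsg)
  have gsg: "smooth_gen V (\<lambda>u. g (phi_arg (a\<^sup>2 * lam) (T u)))" if "smooth1_on I g" for g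
    by (rule smooth_gen.comp[OF argsg that argI])
  have "differential_function_on V (f 1 1)"
    by (rule differential_function_on_cong[OF V(1) smooth_gen.const, of 0 0])
      (use f11 in \<open>auto simp: depends_on_def\<close>)
  moreover have aff: "differential_function_on V g"
    if "\<And>u. u \<in> V \<Longrightarrow> g u = p * (u 0 - lam * u 2) + k" for g p k
    by (rule differential_function_on_cong[OF V(1), of "\<lambda>u. p * (u 0 - lam * u 2) + k" 3])
      (use that in \<open>auto simp: depends_on_def intro!: smooth_gen_intros\<close>)
  moreover have "differential_function_on V (f 1 2)"
  proof (rule differential_function_on_cong[OF V(1)])
    show "smooth_gen V (\<lambda>u. b * (- r * (2 * T u 1 * deriv \<phi> (phi_arg (a\<^sup>2 * lam) (T u)))))"
      by (intro smooth_gen_intros Tsg gsg smooth1_deriv I)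
    show "depends_on V 3 (\<lambda>u. b * (- r * (2 * T u 1 * deriv \<phi> (phi_arg (a\<^sup>2 * lam) (T u)))))"
      by (simp add: depends_on_def phi_arg_def T_def transf_jet_def)
  qed (use f(2)[of _ 1] N(2) in simp)
  moreover have df2: "differential_function_on V g"
    if "\<And>u. u \<in> V \<Longrightarrow> g u = h * flux_Dx (a\<^sup>2 * lam) \<phi> (T u)
        - (p * (u 0 - lam * u 2) + k) * \<phi> (phi_arg (a\<^sup>2 * lam) (T u))" for g h p k
  proof (rule differential_function_on_cong[OF V(1)])
    show "smooth_gen V (\<lambda>u. h * flux_Dx (a\<^sup>2 * lam) \<phi> (T u)
        - (p * (u 0 - lam * u 2) + k) * \<phi> (phi_arg (a\<^sup>2 * lam) (T u)))"
      unfolding flux_Dx_def by (intro smooth_gen_intros Tsg gsg smooth1_deriv I)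
    show "depends_on V 3 (\<lambda>u. h * flux_Dx (a\<^sup>2 * lam) \<phi> (T u)
        - (p * (u 0 - lam * u 2) + k) * \<phi> (phi_arg (a\<^sup>2 * lam) (T u)))"
      by (simp add: depends_on_def flux_Dx_def phi_arg_def T_def transf_jet_def)
  qed (use that in auto)
  moreover have "differential_function_on V (f 2 2)"
  proof (rule df2)
    fix u assume u: "u \<in> V"
    have N1: "N 2 1 (T u) = (p / a) * (u 0 - lam * u 2) + k / a"
      using f(1)[OF u, of 2] f21[OF u] nz(1) by (simp add: field_simps)
    have "f 2 2 u = b * (\<sigma> * flux_Dx (a\<^sup>2 * lam) \<phi> (T u)
      - (p / a * (u 0 - lam * u 2) + k / a) * \<phi> (phi_arg (a\<^sup>2 * lam) (T u)))"
      using f(2)[OF u, of 2] unfolding N(4)[OF u] N1 by simp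
    then show "f 2 2 u = (b * \<sigma>) * flux_Dx (a\<^sup>2 * lam) \<phi> (T u)
      - ((b * (p / a)) * (u 0 - lam * u 2) + b * (k / a)) * \<phi> (phi_arg (a\<^sup>2 * lam) (T u))"
      by (simp add: algebra_simps)
  qed
  moreover have "differential_function_on V (f 3 2)"
  proof (rule df2)
    fix u assume u: "u \<in> V"
    have N1: "N 3 1 (T u) = (q / a) * (u 0 - lam * u 2) + l / a"
      using f(1)[OF u, of 3] f31[OF u] nz(1) by (simp add: field_simps)
    have "f 3 2 u = b * ((\<epsilon> * R) * flux_Dx (a\<^sup>2 * lam) \<phi> (T u)
      - (q / a * (u 0 - lam * u 2) + l / a) * \<phi> (phi_arg (a\<^sup>2 * lam) (T u)))"
      using f(2)[OF u, of 3] unfolding N(6)[OF u] N1 by simp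
    then show "f 3 2 u = (b * (\<epsilon> * R)) * flux_Dx (a\<^sup>2 * lam) \<phi> (T u)
      - ((b * (q / a)) * (u 0 - lam * u 2) + b * (l / a)) * \<phi> (phi_arg (a\<^sup>2 * lam) (T u))"
      by (simp add: algebra_simps)
  qed
  ultimately have "\<forall>i\<in>{1,2,3}. \<forall>j\<in>{1,2}. differential_function_on V (f i j)"
    using aff[OF f21] aff[OF f31] by auto
  then have df: "\<forall>i\<in>{1,2,3}. \<forall>j\<in>{1,2}. differential_function_on V' (f i j)"
    unfolding differential_function_on_iff
    using smooth_subset[OF _ V'sub] depends_on_subset[OF _ V'sub] by blast
  have "describes \<delta> Eq f V'"
    unfolding describes_def
  proof (intro conjI allI impI df ballI)
    fix u assume "u \<in> V'" then show "wedge f 1 2 u \<noteq> 0" by (rule w12)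
  next
    fix U z x t assume "open U \<and> smooth2_on U z \<and> (x, t) \<in> U \<and> zx z x t \<in> V'"
    then have "zx z x t \<in> V" using V'sub by blast
    from structure_equations_iff[OF V(1) this pq f11 f21 f31 S1 S2 S3]
    show "Eq z x t \<longleftrightarrow> structure_equations \<delta> f z x t" by (simp add: Eq)
  qed
  moreover have "admissible \<delta> 0 f V'"
    unfolding admissible_def
  proof (intro conjI ballI)
    have "affine_in_z_z2 V' g" if "\<And>u. u \<in> V \<Longrightarrow> g u = p * (u 0 - lam * u 2) + k" for g p k
      unfolding affine_in_z_z2_def
      by (intro exI[of _ p] exI[of _ "- p * lam"] exI[of _ k])
        (use that V'sub in \<open>auto simp: algebra_simps\<close>)
    then show "affine_in_z_z2 V' (f 2 1)" "affine_in_z_z2 V' (f 3 1)"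
      using f21 f31 by blast+
    fix u assume "u \<in> V'"
    then have u: "u \<in> V" using V'sub by blast
    show "f 1 1 u = 0" using f11[OF u] .
    have "pd 0 g u = p" if "\<And>u. u \<in> V \<Longrightarrow> g u = p * (u 0 - lam * u 2) + k" for g p k
    proof -
      have "has_pd (\<lambda>u. p * (u 0 - lam * u 2) + k) 0 p u"
        by (auto intro!: derivative_eq_intros)
      then show ?thesis
        using has_pd_imp_pd has_pd_cong[OF V(1) u, of "\<lambda>u. p * (u 0 - lam * u 2) + k" g] that by simp
    qed
    from this[OF f21] this[OF f31] show "(pd 0 (f 3 1) u)\<^sup>2 - \<delta> * (pd 0 (f 2 1) u)\<^sup>2 \<noteq> 0"
      using disc0 by simp
  qed
  ultimately show thesis using that V'o V'ne V'sub by blast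
qed

section \<open>From differential equations to identities on jets\<close>

text \<open>Dividing by factorials turns differentiation into a shift of the coefficient
  sequence.\<close>

lemma exp_poly_funpow_deriv:
  fixes c :: "nat \<Rightarrow> real"
  assumes "\<And>i. i \<ge> K \<Longrightarrow> c i = 0"
  shows "(deriv ^^ i) (\<lambda>s. \<Sum>j<K. c j * s ^ j / fact j) = (\<lambda>s. \<Sum>j<K. c (i + j) * s ^ j / fact j)"
proof (induction i)
  case (Suc i)
  have "deriv (\<lambda>s. \<Sum>j<K. c (i + j) * s ^ j / fact j) s = (\<Sum>j<K. c (Suc i + j) * s ^ j / fact j)" for s
  proof (rule DERIV_imp_deriv)
    have "((\<lambda>s. \<Sum>j<K. c (i + j) * s ^ j / fact j) has_field_derivative
        (\<Sum>j<K. c (i + j) * (of_nat j * s ^ (j - 1)) / fact j)) (at s)"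
      by (auto intro!: derivative_eq_intros sum.cong simp: mult_ac)
    \<comment> \<open>The extra summand is zero because the coefficients vanish from
      \<open>K\<close> on. It makes room for the index shift, in which the term for
      \<open>j = 0\<close> drops out.\<close>
    also have "(\<Sum>j<K. c (i + j) * (of_nat j * s ^ (j - 1)) / fact j)
        = (\<Sum>j<Suc K. c (i + j) * (of_nat j * s ^ (j - 1)) / fact j)"
      using assms[of "i + K"] by simp
    also have "\<dots> = (\<Sum>j<K. c (i + Suc j) * (of_nat (Suc j) * s ^ j) / fact (Suc j))"
      by (subst sum.lessThan_Suc_shift) simp
    also have "\<dots> = (\<Sum>j<K. c (Suc i + j) * s ^ j / fact j)"
      by (intro sum.cong refl) (simp add: mult.left_commute del: of_nat_Suc)
    finally show "((\<lambda>s. \<Sum>j<K. c (i + j) * s ^ j / fact j) has_field_derivative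
        (\<Sum>j<K. c (Suc i + j) * s ^ j / fact j)) (at s)" .
  qed
  then show ?case using Suc by simp
qed simp

lemma exp_poly_funpow_deriv_0:
  fixes c :: "nat \<Rightarrow> real"
  assumes "\<And>i. i \<ge> K \<Longrightarrow> c i = 0"
  shows "(deriv ^^ i) (\<lambda>s. \<Sum>j<K. c j * s ^ j / fact j) 0 = c i"
proof -
  have "(\<Sum>j<K. c (i + j) * 0 ^ j / fact j) = (\<Sum>j<K. if j = 0 then c i else 0)"
    by (intro sum.cong) auto
  also have "\<dots> = c i" using assms[of i] by (cases "K = 0") auto
  finally show ?thesis using fun_cong[OF exp_poly_funpow_deriv[of K c i], of 0] assms by simp
qed

text \<open>The witness is a Taylor polynomial in x whose coefficients \<open>u j + v j * t\<close>
  are affine in t, so the t-derivatives at the origin are free of the x-jet.\<close>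

lemma realize_jets:
  fixes u v :: jet
  assumes "\<And>i. i \<ge> K \<Longrightarrow> u i = 0" "\<And>i. i \<ge> K \<Longrightarrow> v i = 0"
  obtains z where "smooth2_on UNIV z" "zx z 0 0 = u" "zxt z 0 0 = v"
proof
  define z where "z = (\<lambda>x t. \<Sum>j<K. (u j + v j * t) * x ^ j / fact j)"
  have zx: "zx z 0 t i = u i + v i * t" for t i
    unfolding zx_def z_def
    using exp_poly_funpow_deriv_0[of K "\<lambda>j. u j + v j * t" i] assms by simp
  then show "zx z 0 0 = u" by auto
  show "zxt z 0 0 = v"
  proof
    fix i
    have "((\<lambda>t. u i + v i * t) has_field_derivative v i) (at 0)"
      by (auto intro!: derivative_eq_intros)
    then show "zxt z 0 0 i = v i" unfolding zxt_def zx by (rule DERIV_imp_deriv)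
  qed
  have "smooth_gen UNIV (\<lambda>w. z (w 0) (w 1))"
    unfolding z_def divide_inverse by (intro smooth_gen_intros)
  then show "smooth2_on UNIV z"
    by (simp add: smooth2_on_def smooth_gen_imp_smooth)
qed

text \<open>At a fixed jet the values of \<open>z_t\<close> and \<open>z_2t\<close> can be
  prescribed freely, which turns the equivalence over all functions \<open>z\<close> into one over
  real numbers \<open>v0\<close>, \<open>v2\<close>.\<close>

lemma describes_imp_jet_equivalence:
  fixes f A B lam \<delta>
  assumes V: "open V" "u \<in> V" and desc: "describes \<delta> (eqn lam A B) f V"
    and f11: "\<And>w. w \<in> V \<Longrightarrow> f 1 1 w = 0"
    and f21: "\<And>w. w \<in> V \<Longrightarrow> f 2 1 w = p * w 0 + p' * w 2 + k"
    and f31: "\<And>w. w \<in> V \<Longrightarrow> f 3 1 w = q * w 0 + q' * w 2 + l"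
  shows "v0 - lam * v2 = rhs A B u \<longleftrightarrow>
     Dx (f 1 2) u = wedge f 3 2 u \<and>
     Dx (f 2 2) u - (p * v0 + p' * v2) = wedge f 1 3 u \<and>
     Dx (f 3 2) u - (q * v0 + q' * v2) = \<delta> * wedge f 1 2 u"
proof -
  obtain N \<rho> where N: "\<rho> > 0" "\<And>v. (\<And>i. i < N \<Longrightarrow> \<bar>v i - u i\<bar> < \<rho>) \<Longrightarrow> v \<in> V"
    using open_jets_contains_box[OF V] by blast
  have df: "differential_function_on V (f i j)" if "i \<in> {1,2,3}" "j \<in> {1,2}" for i j
    using desc that unfolding describes_def by blast
  define n where "n i j = (SOME n. depends_on V n (f i j))" for i j
  have n: "depends_on V (n i j) (f i j)" if "i \<in> {1,2,3}" "j \<in> {1,2}" for i j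
    unfolding n_def using someI_ex[of "\<lambda>n. depends_on V n (f i j)"] df[OF that]
    by (simp add: differential_function_on_iff)
  \<comment> \<open>\<open>K\<close> exceeds the box bound and the orders of all coefficients; the 4
    covers the coordinates 0 to 3 in \<open>rhs\<close>.\<close>
  define K where "K = N + 4 + (\<Sum>i\<in>{1,2,3}. \<Sum>j\<in>{1,2}. n i j)"
  have K: "N \<le> K" "4 \<le> K" "\<And>i j. i \<in> {1,2,3} \<Longrightarrow> j \<in> {1,2} \<Longrightarrow> n i j \<le> K"
    unfolding K_def by auto
  have dep: "depends_on V K (f i j)" if "i \<in> {1,2,3}" "j \<in> {1,2}" for i j
    using depends_on_mono[OF n[OF that] K(3)[OF that]] .
  \<comment> \<open>The truncation stays in \<open>V\<close>. It keeps coordinate \<open>K\<close>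
    as well, because \<open>Dx\<close> of a function of the first \<open>K\<close> coordinates
    reaches it.\<close>
  define u' where "u' = (\<lambda>i. if i < Suc K then u i else 0)"
  define v :: jet where "v = (\<lambda>i. if i = 0 then v0 else if i = 2 then v2 else 0)"
  have u': "u' \<in> V" using N(1) K(1) by (intro N(2)) (auto simp: u'_def)
  obtain z where z: "smooth2_on UNIV z" "zx z 0 0 = u'" "zxt z 0 0 = v"
    using realize_jets[of "Suc K" u' v] K(2) by (auto simp: u'_def v_def)
  have iff: "eqn lam A B z 0 0 \<longleftrightarrow> structure_equations \<delta> f z 0 0"
    using desc[unfolded describes_def, THEN conjunct2, THEN conjunct2, rule_format, of UNIV z 0 0] z u'
    by simp
  have f: "f i j u' = f i j u" if "i \<in> {1,2,3}" "j \<in> {1,2}" for i j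
    by (rule depends_onD[OF dep[OF that] u' V(2)]) (auto simp: u'_def)
  have Dx: "Dx (f i 2) u' = Dx (f i 2) u" if "i \<in> {1,2,3}" for i
  proof -
    have d: "depends_on V K (f i 2)" using dep that by simp
    have "pd j (f i 2) u' = pd j (f i 2) u" for j
      by (rule depends_onD[OF depends_on_pd[OF V(1) d] u' V(2)]) (auto simp: u'_def)
    then show ?thesis
      unfolding Dx_eq_sum[OF V(1) d u'] Dx_eq_sum[OF V(1) d V(2)]
      by (intro sum.cong) (auto simp: u'_def)
  qed
  have aff: "total_deriv g u' v = p * v0 + q * v2"
    if "\<And>w. w \<in> V \<Longrightarrow> g w = p * w 0 + q * w 2 + k" for g p q k
  proof -
    have "has_td (\<lambda>w. p * w 0 + q * w 2 + k) u' v (p * v 0 + q * v 2 + 0)"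
      by (intro has_td_add has_td_cmult has_td_coord has_td_const)
    then have "has_td g u' v (p * v 0 + q * v 2 + 0)"
      using has_td_cong[OF V(1) u', of "\<lambda>w. p * w 0 + q * w 2 + k" g] that by simp
    from has_td_imp_total_deriv[OF this] show ?thesis by (simp add: v_def)
  qed
  have "total_deriv (f 1 1) u' v = 0"
    using aff[of "f 1 1" 0 0 0] f11 by simp
  moreover have "total_deriv (f 2 1) u' v = p * v0 + p' * v2" by (rule aff[OF f21])
  moreover have "total_deriv (f 3 1) u' v = q * v0 + q' * v2" by (rule aff[OF f31])
  moreover have "rhs A B u' = rhs A B u" using K(2) by (simp add: rhs_def u'_def)
  moreover have "wedge f i j u' = wedge f i j u" if "i \<in> {1,2,3}" "j \<in> {1,2,3}" for i j
    using that f by (simp add: wedge_def)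
  ultimately show ?thesis
    using iff unfolding eqn_def structure_equations_def Let_def z ext_d_def
    by (simp add: v_def Dx del: One_nat_def)
qed

lemma describes_imp_system:
  fixes f A B lam \<delta>
  assumes V: "open V" "V \<noteq> {}" and desc: "describes \<delta> (eqn lam A B) f V"
    and f11: "\<And>w. w \<in> V \<Longrightarrow> f 1 1 w = 0"
    and f21: "\<And>w. w \<in> V \<Longrightarrow> f 2 1 w = p * w 0 + p' * w 2 + k"
    and f31: "\<And>w. w \<in> V \<Longrightarrow> f 3 1 w = q * w 0 + q' * w 2 + l"
  shows "p' = - lam * p" "q' = - lam * q"
    "\<And>u. u \<in> V \<Longrightarrow> Dx (f 1 2) u = wedge f 3 2 u"
    "\<And>u. u \<in> V \<Longrightarrow> Dx (f 2 2) u = p * rhs A B u - f 1 2 u * f 3 1 u"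
    "\<And>u. u \<in> V \<Longrightarrow> Dx (f 3 2) u = q * rhs A B u - \<delta> * f 1 2 u * f 2 1 u"
proof -
  note eq = describes_imp_jet_equivalence[OF V(1) _ desc f11 f21 f31, THEN iffD1]
  have w: "wedge f 1 3 u = - f 1 2 u * f 3 1 u" "wedge f 1 2 u = - f 1 2 u * f 2 1 u"
    if "u \<in> V" for u
    using f11[OF that] by (simp_all add: wedge_def)
  obtain u0 where u0: "u0 \<in> V" using V(2) by blast
  have 0: "Dx (f 1 2) u = wedge f 3 2 u" "Dx (f 2 2) u - p * rhs A B u = wedge f 1 3 u"
     "Dx (f 3 2) u - q * rhs A B u = \<delta> * wedge f 1 2 u" if "u \<in> V" for u
    using eq[OF that, of "rhs A B u" 0] by simp_all
  \<comment> \<open>The pairs \<open>(rhs A B u, 0)\<close> and \<open>(rhs A B u + lam, 1)\<close>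
    for \<open>(v0, v2)\<close> both solve the equation; comparing them determines \<open>p'\<close>
    and \<open>q'\<close>.\<close>
  have 1: "Dx (f 2 2) u - (p * (rhs A B u + lam) + p') = wedge f 1 3 u"
     "Dx (f 3 2) u - (q * (rhs A B u + lam) + q') = \<delta> * wedge f 1 2 u" if "u \<in> V" for u
    using eq[OF that, of "rhs A B u + lam" 1] by simp_all
  show "p' = - lam * p" "q' = - lam * q"
    using 0(2,3)[OF u0] 1[OF u0] by (simp_all add: algebra_simps)
  show "Dx (f 1 2) u = wedge f 3 2 u" if "u \<in> V" for u using 0(1)[OF that] .
  show "Dx (f 2 2) u = p * rhs A B u - f 1 2 u * f 3 1 u" if "u \<in> V" for u
    using 0(2)[OF that] w(1)[OF that] by simp
  show "Dx (f 3 2) u = q * rhs A B u - \<delta> * f 1 2 u * f 2 1 u" if "u \<in> V" for u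
    using 0(3)[OF that] w(2)[OF that] by simp
qed

section \<open>Reduction of the order\<close>

text \<open>On a box, unlike on an arbitrary open set, a function with \<open>F\<^sub>,\<^sub>z\<^sub>n = 0\<close> does not depend on \<open>z\<^sub>n\<close>.\<close>

definition jbox :: "jet \<Rightarrow> nat \<Rightarrow> real \<Rightarrow> jet set" where
  "jbox c N \<rho> = {v. \<forall>i<N. \<bar>v i - c i\<bar> < \<rho>}"

lemma open_jbox: "open (jbox c N \<rho>)"
  unfolding jbox_def by (rule open_box)

lemma jbox_upd: "u \<in> jbox c N \<rho> \<Longrightarrow> v \<in> jbox c N \<rho> \<Longrightarrow> u(i := v i) \<in> jbox c N \<rho>"
  by (simp add: jbox_def)

text \<open>A slice of a box is an interval, the whole line or empty; convexity lets a zero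
  derivative imply constancy.\<close>

lemma convex_jbox_slice: "convex {s. u(i := s) \<in> jbox c N \<rho>}"
proof -
  have "{s. u(i := s) \<in> jbox c N \<rho>} =
     (if \<forall>j<N. j \<noteq> i \<longrightarrow> \<bar>u j - c j\<bar> < \<rho> then if i < N then ball (c i) \<rho> else UNIV else {})"
    by (auto simp: jbox_def dist_real_def abs_minus_commute)
  then show ?thesis by simp
qed

text \<open>From \<open>u\<close> one moves inside the box to \<open>u(n := v n)\<close>, along
  which \<open>F\<close> is constant, and this point agrees with \<open>v\<close> in the first
  \<open>n + 1\<close> coordinates.\<close>

lemma depends_on_reduce:
  assumes W: "W = jbox c N \<rho>" and F: "smooth_jet_on W F" "depends_on W (Suc n) F"
    and pd0: "\<And>u. u \<in> W \<Longrightarrow> pd n F u = 0"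
  shows "depends_on W n F"
  unfolding depends_on_def
proof (intro ballI impI)
  fix u v assume uv: "u \<in> W" "v \<in> W" "\<forall>i<n. u i = v i"
  define S where "S = {s. u(n := s) \<in> W}"
  have w: "u(n := v n) \<in> W" using jbox_upd uv W by simp
  have "((\<lambda>s. F (u(n := s))) has_field_derivative 0) (at s within S)" if "s \<in> S" for s
  proof -
    have "u(n := s) \<in> W" using that by (simp add: S_def)
    from smooth_imp_has_pd[OF F(1) this, of n] pd0[OF this]
    show ?thesis using has_field_derivative_at_within by simp
  qed
  then have "\<exists>k. \<forall>s\<in>S. F (u(n := s)) = k"
    using convex_jbox_slice unfolding S_def W by (intro has_field_derivative_zero_constant) auto
  then have "F (u(n := u n)) = F (u(n := v n))"
    using uv(1) w by (metis (mono_tags, lifting) S_def fun_upd_triv mem_Collect_eq)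
  also have "\<dots> = F v"
    by (rule depends_onD[OF F(2) w uv(2)]) (use uv(3) in auto)
  finally show "F u = F v" by simp
qed

text \<open>\<open>z\<^sub>n\<^sub>+\<^sub>1\<close> occurs in \<open>D\<^sub>x F\<close> only with the coefficient \<open>F\<^sub>,\<^sub>z\<^sub>n\<close>.\<close>

lemma order_drop:
  assumes W: "W = jbox c N \<rho>" and F: "smooth_jet_on W F" "depends_on W (Suc n) F"
    and eq: "\<And>u. u \<in> W \<Longrightarrow> Dx F u = H u" and H: "depends_on W (Suc n) H"
  shows "depends_on W n F"
proof (rule depends_on_reduce[OF W F])
  fix u assume u: "u \<in> W"
  have oW: "open W" by (simp add: W open_jbox)
  obtain s where s: "u(Suc n := s) \<in> W" "s \<notin> {u (Suc n)}"
    using open_jet_avoid[OF oW u, of "{u (Suc n)}" "Suc n"] by blast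
  define w where "w = u(Suc n := s)"
  have w: "w \<in> W" using s by (simp add: w_def)
  have p: "pd i F w = pd i F u" for i
    by (rule depends_onD[OF depends_on_pd[OF oW F(2)] w u]) (simp add: w_def)
  have "H w = H u" by (rule depends_onD[OF H w u]) (simp add: w_def)
  then have "Dx F w = Dx F u" using eq u w by simp
  then have "(\<Sum>i<Suc n. w (Suc i) * pd i F u) = (\<Sum>i<Suc n. u (Suc i) * pd i F u)"
    using Dx_eq_sum[OF oW F(2)] u w p by simp
  moreover have "(\<Sum>i<n. w (Suc i) * pd i F u) = (\<Sum>i<n. u (Suc i) * pd i F u)"
    by (intro sum.cong) (auto simp: w_def)
  ultimately have "w (Suc n) * pd n F u = u (Suc n) * pd n F u" by simp
  then show "pd n F u = 0" using s by (simp add: w_def)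
qed

section \<open>Lowering the order of the reduced system\<close>

lemma depends_on_binary:
  assumes "depends_on V n F" "depends_on V n G"
  shows "depends_on V n (\<lambda>u. g (F u) (G u))"
  unfolding depends_on_def
proof (intro ballI impI)
  fix u v assume "u \<in> V" "v \<in> V" "\<forall>i<n. u i = v i"
  then have "F u = F v" "G u = G v"
    by (auto intro: depends_onD[OF assms(1)] depends_onD[OF assms(2)])
  then show "g (F u) (G u) = g (F v) (G v)" by simp
qed

lemmas depends_on_intros = depends_on_binary[of _ _ _ _ "(+)"] depends_on_binary[of _ _ _ _ "(-)"]
  depends_on_binary[of _ _ _ _ "(*)"] depends_on_binary[of _ _ _ _ "(/)"]
  depends_on_binary[of _ _ F F "\<lambda>a _. - a" for F]

lemma depends_on_const: "depends_on V n (\<lambda>_. k)"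
  by (simp add: depends_on_def)

text \<open>Above three coordinates every right-hand side has at most the common order of
  \<open>h\<close>, \<open>P\<close>, \<open>Q\<close> and \<open>G\<close>, so all three unknowns
  drop together. \<open>G\<close> involves four coordinates, which stops \<open>Q\<close> at
  three.\<close>

lemma order_drop_system:
  assumes W: "W = jbox c N \<rho>"
    and h: "smooth_jet_on W h" "depends_on W n h" and P: "smooth_jet_on W P" "depends_on W n P"
    and Q: "smooth_jet_on W Q" "depends_on W n Q" and G: "depends_on W 4 G" and M: "depends_on W 3 M"
    and Dh: "\<And>u. u \<in> W \<Longrightarrow> Dx h u = (M u * P u - \<kappa> * Q u) / \<Delta>"
    and DP: "\<And>u. u \<in> W \<Longrightarrow> Dx P u = - M u * h u"
    and DQ: "\<And>u. u \<in> W \<Longrightarrow> Dx Q u = \<Delta> * G u - \<mu> * h u"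
  shows "depends_on W 2 h \<and> depends_on W 2 P"
proof -
  have *: "depends_on W 3 h \<and> depends_on W 3 P \<and> depends_on W 3 Q"
    if "depends_on W (m + 3) h" "depends_on W (m + 3) P" "depends_on W (m + 3) Q" for m
    using that
  proof (induction m)
    case (Suc m)
    then have d: "depends_on W (Suc (m + 3)) h" "depends_on W (Suc (m + 3)) P"
       "depends_on W (Suc (m + 3)) Q" by simp_all
    have d': "depends_on W (Suc (m + 3)) M" "depends_on W (Suc (m + 3)) G"
      using depends_on_mono[OF M] depends_on_mono[OF G] by simp_all
    note D = d d'
    have "depends_on W (m + 3) h"
      by (rule order_drop[OF W h(1) d(1) Dh]) (assumption, intro depends_on_intros depends_on_const D)
    moreover have "depends_on W (m + 3) P"
      by (rule order_drop[OF W P(1) d(2) DP]) (assumption, intro depends_on_intros depends_on_const D)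
    moreover have "depends_on W (m + 3) Q"
      by (rule order_drop[OF W Q(1) d(3) DQ]) (assumption, intro depends_on_intros depends_on_const D)
    ultimately show ?case using Suc.IH by blast
  qed simp
  have d: "depends_on W 3 h" "depends_on W 3 P" "depends_on W 3 Q"
    using *[of n] depends_on_mono[OF h(2)] depends_on_mono[OF P(2)] depends_on_mono[OF Q(2)] by simp_all
  \<comment> \<open>The equations for \<open>h\<close> and \<open>P\<close> contain only functions
    of three coordinates, which allows one more drop.\<close>
  have 3: "3 = Suc 2" by simp
  note D = d[unfolded 3] M[unfolded 3]
  have "depends_on W 2 h"
    by (rule order_drop[OF W h(1) d(1)[unfolded 3] Dh]) (assumption, intro depends_on_intros depends_on_const D)
  moreover have "depends_on W 2 P"
    by (rule order_drop[OF W P(1) d(2)[unfolded 3] DP]) (assumption, intro depends_on_intros depends_on_const D)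
  ultimately show ?thesis by simp
qed

text \<open>Both sides are affine in the coordinate 2 with coefficients depending on the first two
  coordinates; changing that coordinate alone separates the coefficients.\<close>

lemma Dx_order_1_split:
  assumes W: "open W" and F: "depends_on W 2 F" and K: "depends_on W 2 K"
    and eq: "\<And>u. u \<in> W \<Longrightarrow> Dx F u = (u 0 + y0 - lam * u 2) * K u" and u: "u \<in> W"
  shows "u 1 * pd 0 F u = (u 0 + y0) * K u" "pd 1 F u = - lam * K u"
proof -
  have Dx: "Dx F w = w 1 * pd 0 F w + w 2 * pd 1 F w" if "w \<in> W" for w
    using Dx_eq_sum[OF W F that] by (simp add: numeral_2_eq_2)
  obtain s where s: "u(2 := s) \<in> W" "s \<notin> {u 2}"
    using open_jet_avoid[OF W u, of "{u 2}" 2] by blast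
  define w where "w = u(2 := s)"
  have w: "w \<in> W" using s by (simp add: w_def)
  have p: "pd i F w = pd i F u" for i
    by (rule depends_onD[OF depends_on_pd[OF W F] w u]) (simp add: w_def)
  have k: "K w = K u" by (rule depends_onD[OF K w u]) (simp add: w_def)
  have 1: "u 1 * pd 0 F u + u 2 * pd 1 F u = (u 0 + y0 - lam * u 2) * K u"
    using eq[OF u] Dx[OF u] by simp
  have 2: "u 1 * pd 0 F u + s * pd 1 F u = (u 0 + y0 - lam * s) * K u"
    using eq[OF w] Dx[OF w] p k by (simp add: w_def)
  have "(s - u 2) * (pd 1 F u + lam * K u) = 0"
    using 1 2 by (simp add: algebra_simps)
  then show "pd 1 F u = - lam * K u" using s by simp
  with 1 show "u 1 * pd 0 F u = (u 0 + y0) * K u" by (simp add: algebra_simps)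
qed

section \<open>Integration along the level curves of the argument of the normal form\<close>

lemma smooth1_slice:
  assumes "open V" "smooth_jet_on V F"
  shows "smooth1_on {s. c(i := s) \<in> V} (\<lambda>s. F (c(i := s)))"
  unfolding smooth1_on_def
\<comment> \<open>The zero function is in the class because the derivatives in the other coordinates
  vanish.\<close>
proof (rule smooth_coinduct[where
      C = "\<lambda>G. G = (\<lambda>_. 0) \<or> (\<exists>F. smooth_jet_on V F \<and> G = (\<lambda>w. F (c(i := w 0))))"])
  let ?S = "{w::jet. w 0 \<in> {s. c(i := s) \<in> V}}"
  have "open ((\<lambda>w::jet. w 0) -` {s. c(i := s) \<in> V})"
    by (rule open_vimage[OF open_slice[OF assms(1)]]) (rule continuous_on_coordinate)
  then show "open ?S" by (simp add: vimage_def)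
  show "(\<lambda>w. F (c(i := w 0))) = (\<lambda>_. 0) \<or>
     (\<exists>G. smooth_jet_on V G \<and> (\<lambda>w::jet. F (c(i := w 0))) = (\<lambda>w. G (c(i := w 0))))"
    using assms(2) by blast
  let ?C = "\<lambda>G. G = (\<lambda>_. 0) \<or> (\<exists>F. smooth_jet_on V F \<and> G = (\<lambda>w::jet. F (c(i := w 0))))"
  fix G :: "jet \<Rightarrow> real"
  assume "?C G"
  then show "continuous_on ?S G \<and> (\<forall>j. \<exists>H. ?C H \<and> (\<forall>u\<in>?S. has_pd G j (H u) u))"
  proof
    assume "G = (\<lambda>_. 0)" then show ?thesis by auto
  next
    assume "\<exists>F. smooth_jet_on V F \<and> G = (\<lambda>w. F (c(i := w 0)))"
    then obtain F where F: "smooth_jet_on V F" "G = (\<lambda>w. F (c(i := w 0)))" by blast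
    have "continuous_on ?S G" unfolding F(2)
      by (rule continuous_on_compose2[OF smooth_imp_continuous[OF F(1)]], intro continuous_intros) auto
    moreover have "\<exists>H. ?C H \<and> (\<forall>u\<in>?S. has_pd G j (H u) u)" for j
    proof (cases "j = 0")
      case True
      have "has_pd G 0 (pd i F (c(i := u 0))) u" if "u \<in> ?S" for u
        using smooth_imp_has_pd[OF F(1), of "c(i := u 0)" i] that by (simp add: F(2))
      then show ?thesis using True smooth_pd[OF F(1), of i]
        by (intro exI[of _ "\<lambda>w. pd i F (c(i := w 0))"]) auto
    next
      case False
      then show ?thesis by (intro exI[of _ "\<lambda>_. 0"]) (auto simp: F(2))
    qed
    ultimately show ?thesis by blast
  qed
qed

text \<open>Multiples of powers of the first coordinate are closed under differentiation; the
  factors 1 and 0 bring the root and the vanishing derivatives into this shape.\<close>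

lemma smooth1_sqrt: "smooth1_on {0<..} sqrt"
  unfolding smooth1_on_def
proof (rule smooth_cong[of _ "\<lambda>w. 1 * w 0 powr (1/2)"])
  have *: "open {w::jet. w 0 \<in> {0<..}}"
    using open_vimage[OF open_greaterThan continuous_on_coordinate[of UNIV 0], of "0::real"]
    by (simp add: vimage_def)
  then show "open {w::jet. w 0 \<in> {0<..}}" .
  show "smooth_jet_on {w. w 0 \<in> {0<..}} (\<lambda>w. 1 * w 0 powr (1/2))"
  proof (rule smooth_coinduct[OF *, where C = "\<lambda>G. \<exists>k p. G = (\<lambda>w. k * w 0 powr p)"])
    show "\<exists>k p. (\<lambda>w::jet. 1 * w 0 powr (1/2)) = (\<lambda>w. k * w 0 powr p)" by blast
    fix G :: "jet \<Rightarrow> real" assume "\<exists>k p. G = (\<lambda>w. k * w 0 powr p)"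
    then obtain k p where G: "G = (\<lambda>w. k * w 0 powr p)" by blast
    have "continuous_on {w::jet. w 0 \<in> {0<..}} G"
      unfolding G by (intro continuous_intros) auto
    moreover have "\<exists>H. (\<exists>k p. H = (\<lambda>w. k * w 0 powr p)) \<and>
        (\<forall>u\<in>{w. w 0 \<in> {0<..}}. has_pd G j (H u) u)" for j
    proof (cases "j = 0")
      case True
      have "has_pd G 0 (k * p * u 0 powr (p - 1)) u" if "u 0 > 0" for u
        unfolding G using that by (auto intro!: derivative_eq_intros simp: has_real_derivative_powr)
      then show ?thesis using True by (intro exI[of _ "\<lambda>w. k * p * w 0 powr (p - 1)"]) auto
    next
      case False
      then show ?thesis unfolding G
        by (intro exI[of _ "\<lambda>w. 0 * w 0 powr 0"]) (auto intro!: exI[of _ 0])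
    qed
    ultimately show "continuous_on {w. w 0 \<in> {0<..}} G \<and>
         (\<forall>i. \<exists>H. (\<exists>k p. H = (\<lambda>w. k * w 0 powr p)) \<and>
              (\<forall>u\<in>{w. w 0 \<in> {0<..}}. has_pd G i (H u) u))" by blast
  qed
  show "1 * u 0 powr (1/2) = sqrt (u 0)" if "u \<in> {w. w 0 \<in> {0<..}}" for u :: jet
    using that by (simp add: powr_half_sqrt)
qed

text \<open>Continuity of the partial derivatives gives total differentiability, needed to
  differentiate along curves in the plane of the first two coordinates.\<close>

lemma has_derivative_two_coordinates:
  assumes V: "open V" and F: "smooth_jet_on V F" and c: "c(0 := a, 1 := b) \<in> V"
  shows "((\<lambda>(x, y). F (c(0 := x, 1 := y))) has_derivative
    (\<lambda>(tx, ty). pd 0 F (c(0 := a, 1 := b)) * tx + pd 1 F (c(0 := a, 1 := b)) * ty)) (at (a, b))"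
proof -
  define U where "U = (\<lambda>p::real\<times>real. c(0 := fst p, 1 := snd p))"
  have cU: "continuous_on S U" for S
    unfolding U_def by (intro continuous_intros)
  have "open (U -` V)" by (rule open_vimage[OF V cU])
  moreover have "(a, b) \<in> U -` V" using c by (simp add: U_def)
  ultimately obtain X Y where XY: "open X" "open Y" "(a, b) \<in> X \<times> Y" "X \<times> Y \<subseteq> U -` V"
    by (rule open_prod_elim)
  \<comment> \<open>The second factor is shrunk to a ball since
    \<open>has_derivative_partialsI\<close> asks for convexity there.\<close>
  obtain \<epsilon> where e: "\<epsilon> > 0" "ball b \<epsilon> \<subseteq> Y" using XY(2,3) open_contains_ball by blast
  have inV: "c(0 := x, 1 := y) \<in> V" if "x \<in> X" "y \<in> ball b \<epsilon>" for x y
  proof -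
    have "(x, y) \<in> U -` V" using XY(4) e(2) that by blast
    then show ?thesis by (simp add: U_def)
  qed
  have "((\<lambda>(x, y). F (c(0 := x, 1 := y))) has_derivative
    (\<lambda>(tx, ty). (*) (pd 0 F (c(0 := a, 1 := b))) tx
        + blinfun_apply (blinfun_mult_right (pd 1 F (c(0 := a, 1 := b)))) ty))
      (at (a, b) within X \<times> ball b \<epsilon>)"
  proof (rule has_derivative_partialsI[where
        fy = "\<lambda>x y. blinfun_mult_right (pd 1 F (c(0 := x, 1 := y)))" and Y = "ball b \<epsilon>"])
    have "((c(0 := a, 1 := b))(0 := x)) = c(0 := x, 1 := b)" for x
      by (auto simp: fun_upd_twist)
    then show "((\<lambda>x. F (c(0 := x, 1 := b))) has_derivative (*) (pd 0 F (c(0 := a, 1 := b)))) (at a within X)"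
      using has_field_derivative_at_within[OF smooth_imp_has_pd[OF F c, of 0], of X]
      by (simp add: has_field_derivative_def del: fun_upd_apply) (simp add: fun_upd_apply)
    fix x y assume xy: "x \<in> X" "y \<in> ball b \<epsilon>"
    show "((\<lambda>y. F (c(0 := x, 1 := y))) has_derivative
        blinfun_apply (blinfun_mult_right (pd 1 F (c(0 := x, 1 := y))))) (at y within ball b \<epsilon>)"
      using has_field_derivative_at_within[OF smooth_imp_has_pd[OF F inV[OF xy], of 1], of "ball b \<epsilon>"]
      by (simp add: has_field_derivative_def)
  next
    have "continuous_on (X \<times> ball b \<epsilon>) (\<lambda>p. pd 1 F (U p))"
      by (rule continuous_on_compose2[OF smooth_imp_continuous[OF smooth_pd[OF F]] cU])
        (use inV in \<open>auto simp: U_def\<close>)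
    then have "continuous_on (X \<times> ball b \<epsilon>) (\<lambda>p. blinfun_mult_right (pd 1 F (U p)))"
      by (rule bounded_linear.continuous_on[OF bounded_linear_blinfun_mult_right])
    then have "continuous (at (a, b) within X \<times> ball b \<epsilon>) (\<lambda>p. blinfun_mult_right (pd 1 F (U p)))"
      using XY(3) e(1) by (auto simp: continuous_on_eq_continuous_within)
    then show "continuous (at (a, b) within X \<times> ball b \<epsilon>)
        (\<lambda>(x, y). blinfun_mult_right (pd 1 F (c(0 := x, 1 := y))))"
      by (simp add: U_def case_prod_unfold)
  qed (use e in auto)
  moreover have "at (a, b) within X \<times> ball b \<epsilon> = at (a, b)"
    by (rule at_within_open) (use XY e in \<open>auto intro: open_Times\<close>)
  ultimately show ?thesis by simp
qed

lemma DERIV_two_coordinates: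
  assumes "open V" "smooth_jet_on V F" "c(0 := \<alpha> t, 1 := \<beta> t) \<in> V"
    and "(\<alpha> has_field_derivative \<alpha>') (at t)" "(\<beta> has_field_derivative \<beta>') (at t)"
  shows "((\<lambda>t. F (c(0 := \<alpha> t, 1 := \<beta> t))) has_field_derivative
    pd 0 F (c(0 := \<alpha> t, 1 := \<beta> t)) * \<alpha>' + pd 1 F (c(0 := \<alpha> t, 1 := \<beta> t)) * \<beta>') (at t)"
proof -
  have "((\<lambda>t. (\<alpha> t, \<beta> t)) has_derivative (\<lambda>h. (\<alpha>' * h, \<beta>' * h))) (at t)"
    using assms(4,5) unfolding has_field_derivative_def by (rule has_derivative_Pair)
  from has_derivative_compose[OF this has_derivative_two_coordinates[OF assms(1-3)]]
  have "((\<lambda>t. F (c(0 := \<alpha> t, 1 := \<beta> t))) has_derivative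
    (\<lambda>h. pd 0 F (c(0 := \<alpha> t, 1 := \<beta> t)) * (\<alpha>' * h) + pd 1 F (c(0 := \<alpha> t, 1 := \<beta> t)) * (\<beta>' * h))) (at t)"
    by (simp add: case_prod_unfold)
  then show ?thesis
    unfolding has_field_derivative_def by (rule has_derivative_eq_rhs) (auto simp: algebra_simps)
qed

text \<open>The level curves are parametrised by \<open>z\<^sub>1 = \<tau>\<close>, with \<open>z + y0\<close> the square root \<open>Y t \<tau>\<close> of
  \<open>lam \<tau>\<^sup>2 - t\<close> that has the sign of \<open>c 0 + y0\<close>; this also covers \<open>lam = 0\<close>.\<close>

lemma integrate_phi_arg:
  fixes lam y0 :: real
  assumes W: "open W" and c: "c \<in> W" and c0: "c 0 + y0 \<noteq> 0"
    and P: "smooth_jet_on W P" "depends_on W 2 P"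
    and eq: "\<And>u. u \<in> W \<Longrightarrow> lam * u 1 * pd 0 P u + (u 0 + y0) * pd 1 P u = 0"
  defines "s \<equiv> \<lambda>u. lam * (u 1)\<^sup>2 - (u 0 + y0)\<^sup>2"
  obtains V I T \<phi> where "open V" "c \<in> V" "V \<subseteq> W" "open I" "open T" "c 1 \<in> T" "smooth1_on I \<phi>"
    "\<And>u. u \<in> V \<Longrightarrow> s u \<in> I \<and> u 0 + y0 \<noteq> 0 \<and> P u = \<phi> (s u)"
    "\<And>t \<tau>. t \<in> I \<Longrightarrow> \<tau> \<in> T \<Longrightarrow> \<exists>u\<in>V. s u = t \<and> u 1 = \<tau>"
proof -
  define sg where "sg = sgn (c 0 + y0)"
  have sg: "sg * sg = 1" using c0 by (simp add: sg_def sgn_if)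
  define Y where "Y t \<tau> = sg * sqrt (lam * \<tau>\<^sup>2 - t)" for t \<tau>
  define U where "U t \<tau> = c(0 := Y t \<tau> - y0, 1 := \<tau>)" for t \<tau>
  have sgY: "sg * y > 0 \<Longrightarrow> sg * \<bar>y\<bar> = y" for y
    using sg by (cases "y > 0") (auto simp: sg_def sgn_if split: if_splits)
  have Ys: "Y (lam * \<tau>\<^sup>2 - y\<^sup>2) \<tau> = y" if "sg * y > 0" for \<tau> y
    using sgY[OF that] by (simp add: Y_def)
  have Y2: "(Y t \<tau>)\<^sup>2 = lam * \<tau>\<^sup>2 - t" "sg * Y t \<tau> > 0" if "lam * \<tau>\<^sup>2 - t > 0" for t \<tau>
  proof -
    have "(Y t \<tau>)\<^sup>2 = (sg * sg) * (sqrt (lam * \<tau>\<^sup>2 - t))\<^sup>2" by (simp add: Y_def power2_eq_square)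
    then show "(Y t \<tau>)\<^sup>2 = lam * \<tau>\<^sup>2 - t" using that sg by simp
    have "sg * Y t \<tau> = (sg * sg) * sqrt (lam * \<tau>\<^sup>2 - t)" by (simp add: Y_def)
    then show "sg * Y t \<tau> > 0" using that sg by simp
  qed
  have sgc: "sg * (c 0 + y0) > 0" using c0 by (simp add: sg_def sgn_if)
  define O1 where "O1 = {p. lam * (snd p)\<^sup>2 - fst p > 0}"
  \<comment> \<open>On \<open>O1\<close> the root is positive; \<open>O2\<close> also keeps the
    curves in \<open>W\<close>. A product neighbourhood in \<open>O2\<close> then makes level and
    curve parameter independent.\<close>
  define O2 where "O2 = O1 \<inter> (\<lambda>p. U (fst p) (snd p)) -` W"
  have "open O1" unfolding O1_def by (intro open_Collect_less continuous_intros)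
  moreover have "continuous_on O1 (\<lambda>p. U (fst p) (snd p))"
    unfolding U_def Y_def by (intro continuous_intros)
  ultimately have "open O2" unfolding O2_def using W continuous_open_preimage by blast
  moreover have "(s c, c 1) \<in> O2"
  proof -
    have "U (s c) (c 1) = c" using Ys[OF sgc] by (simp add: U_def s_def)
    then show ?thesis using c c0 by (simp add: O2_def O1_def s_def)
  qed
  ultimately obtain I T where IT: "open I" "open T" "(s c, c 1) \<in> I \<times> T" "I \<times> T \<subseteq> O2"
    by (rule open_prod_elim)
  obtain \<epsilon> where e: "\<epsilon> > 0" "ball (c 1) \<epsilon> \<subseteq> T" using IT open_contains_ball by blast
  \<comment> \<open>The parameter range must be an interval for a zero derivative to give
    constancy.\<close>
  define T' where "T' = ball (c 1) \<epsilon>"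
  have rect: "lam * \<tau>\<^sup>2 - t > 0" "U t \<tau> \<in> W" if "t \<in> I" "\<tau> \<in> T'" for t \<tau>
  proof -
    have "(t, \<tau>) \<in> O2" using IT(4) e(2) that unfolding T'_def by blast
    then show "lam * \<tau>\<^sup>2 - t > 0" "U t \<tau> \<in> W" by (simp_all add: O2_def O1_def)
  qed
  have cT: "c 1 \<in> T'" using e by (simp add: T'_def)
  \<comment> \<open>\<phi> reads \<open>P\<close> off where the level curves meet the cross-section
    \<open>u 1 = c 1\<close>.\<close>
  define \<phi> where "\<phi> t = P (U t (c 1))" for t
  \<comment> \<open>\<open>s u\<close> and \<open>u 1\<close> determine \<open>u 0 + y0\<close> only
    up to sign; the last condition selects the branch of \<open>c\<close>.\<close>
  define V where "V = {u \<in> W. (s u, u 1, sg * (u 0 + y0)) \<in> I \<times> T' \<times> {0<..}}"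
  have const: "P (U t \<tau>) = \<phi> t" if t: "t \<in> I" and \<tau>: "\<tau> \<in> T'" for t \<tau>
  proof -
    have "((\<lambda>\<tau>. P (U t \<tau>)) has_field_derivative 0) (at \<tau>)" if \<tau>: "\<tau> \<in> T'" for \<tau>
    proof -
      note r = rect[OF t \<tau>]
      have Yn: "Y t \<tau> \<noteq> 0" using Y2(2)[OF r(1)] by auto
      have inner: "((\<lambda>\<tau>. lam * \<tau>\<^sup>2 - t) has_field_derivative lam * (2 * \<tau>)) (at \<tau>)"
        by (auto intro!: derivative_eq_intros)
      have "((\<lambda>\<tau>. sg * sqrt (lam * \<tau>\<^sup>2 - t) - y0) has_field_derivative
          sg * (inverse (sqrt (lam * \<tau>\<^sup>2 - t)) / 2 * (lam * (2 * \<tau>))) - 0) (at \<tau>)"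
        by (intro DERIV_diff DERIV_const DERIV_cmult DERIV_chain2[OF DERIV_real_sqrt[OF r(1)] inner])
      moreover have "sg * (inverse (sqrt (lam * \<tau>\<^sup>2 - t)) / 2 * (lam * (2 * \<tau>))) - 0 = lam * \<tau> / Y t \<tau>"
      proof -
        have "inverse (Y t \<tau>) = sg * inverse (sqrt (lam * \<tau>\<^sup>2 - t))"
          unfolding Y_def inverse_mult_distrib inverse_unique[OF sg] ..
        then show ?thesis unfolding divide_inverse by simp
      qed
      ultimately have "((\<lambda>\<tau>. Y t \<tau> - y0) has_field_derivative lam * \<tau> / Y t \<tau>) (at \<tau>)"
        by (simp add: Y_def)
      \<comment> \<open>The curve has velocity \<open>(lam * \<tau> / Y t \<tau>, 1)\<close>, so the
        derivative of \<open>P\<close> along it is \<open>eq\<close> divided by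
        \<open>Y t \<tau>\<close>.\<close>
      from DERIV_two_coordinates[OF W P(1) r(2)[unfolded U_def] this DERIV_ident]
      have "((\<lambda>\<tau>. P (U t \<tau>)) has_field_derivative
          pd 0 P (U t \<tau>) * (lam * \<tau> / Y t \<tau>) + pd 1 P (U t \<tau>)) (at \<tau>)"
        by (simp add: U_def)
      moreover have "pd 0 P (U t \<tau>) * (lam * \<tau> / Y t \<tau>) + pd 1 P (U t \<tau>) = 0"
        using eq[OF r(2)] Yn by (simp add: U_def field_simps)
      ultimately show ?thesis by simp
    qed
    then have "\<exists>k. \<forall>\<tau>\<in>T'. P (U t \<tau>) = k"
      by (intro has_field_derivative_zero_constant)
        (auto simp: T'_def intro: has_field_derivative_at_within)
    then show ?thesis using \<tau> cT by (auto simp: \<phi>_def)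
  qed
  show thesis
  proof (rule that[of V I T' \<phi>])
    show "open V" unfolding V_def s_def
      by (rule open_jet_vimage[OF W])
        (auto intro!: continuous_intros open_Times simp: IT T'_def)
    show "c \<in> V" using c IT(3) cT sgc by (simp add: V_def)
    show "V \<subseteq> W" by (auto simp: V_def)
    show "open I" "open T'" "c 1 \<in> T'" using IT cT by (simp_all add: T'_def)
    \<comment> \<open>On the cross-section \<phi> is a slice of \<open>P\<close> composed with the
      root of a positive affine function, hence smooth.\<close>
    have UU: "U t (c 1) = c(0 := sg * sqrt (lam * (c 1)\<^sup>2 - t) - y0)" for t
      by (auto simp: U_def Y_def)
    have pos: "0 < lam * (c 1)\<^sup>2 - t" and slice: "c(0 := sg * sqrt (lam * (c 1)\<^sup>2 - t) - y0) \<in> W"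
      if "t \<in> I" for t
      using rect(1)[OF that cT] rect(2)[OF that cT, unfolded UU] by simp_all
    have "smooth_gen {w. w 0 \<in> I} (\<lambda>w. sqrt (lam * (c 1)\<^sup>2 - w 0))"
      by (rule smooth_gen.comp[OF _ smooth1_sqrt]) (use pos in \<open>auto intro!: smooth_gen_intros\<close>)
    then have "smooth_gen {w. w 0 \<in> I} (\<lambda>w. sg * sqrt (lam * (c 1)\<^sup>2 - w 0) - y0)"
      by (intro smooth_gen_intros)
    from smooth_gen.comp[OF this smooth1_slice[OF W P(1), of c 0]]
    have "smooth_gen {w. w 0 \<in> I} (\<lambda>w. \<phi> (w 0))"
      unfolding \<phi>_def UU using slice by simp
    moreover have "open {w::jet. w 0 \<in> I}"
      using open_vimage[OF IT(1) continuous_on_coordinate[of UNIV 0]] by (simp add: vimage_def)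
    ultimately show "smooth1_on I \<phi>"
      unfolding smooth1_on_def using smooth_gen_imp_smooth by blast
    show "s u \<in> I \<and> u 0 + y0 \<noteq> 0 \<and> P u = \<phi> (s u)" if u: "u \<in> V" for u
    proof -
      have u': "u \<in> W" "s u \<in> I" "u 1 \<in> T'" "sg * (u 0 + y0) > 0" using u by (auto simp: V_def)
      have "Y (s u) (u 1) = u 0 + y0" unfolding s_def by (rule Ys[OF u'(4)])
      then have U0: "U (s u) (u 1) 0 = u 0" "U (s u) (u 1) 1 = u 1" by (simp_all add: U_def)
      have "P u = P (U (s u) (u 1))"
        by (rule depends_onD[OF P(2) u'(1) rect(2)[OF u'(2,3)]])
          (use U0 in \<open>auto simp: less_2_cases_iff\<close>)
      then show ?thesis using const[OF u'(2,3)] u' by auto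
    qed
    show "\<exists>u\<in>V. s u = t \<and> u 1 = \<tau>" if "t \<in> I" "\<tau> \<in> T'" for t \<tau>
    proof
      have "s (U t \<tau>) = t" "sg * (U t \<tau> 0 + y0) > 0"
        using Y2[OF rect(1)[OF that]] by (simp_all add: s_def U_def)
      then show "U t \<tau> \<in> V" "s (U t \<tau>) = t \<and> U t \<tau> 1 = \<tau>"
        using rect(2)[OF that] that by (simp_all add: V_def) (simp_all add: U_def)
    qed
  qed
qed

section \<open>The classification\<close>

lemma phi_arg_transf_jet:
  "phi_arg lam (transf_jet 1 1 y0 u) = lam * (u 1)\<^sup>2 - (u 0 + y0)\<^sup>2"
  by (simp add: phi_arg_def transf_jet_def)

lemma has_pd_comp_phi_arg:
  assumes "(g has_field_derivative D) (at (lam * (u 1)\<^sup>2 - (u 0 + y0)\<^sup>2))"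
  shows "has_pd (\<lambda>u. g (lam * (u 1)\<^sup>2 - (u 0 + y0)\<^sup>2)) 0 (D * (- 2 * (u 0 + y0))) u"
proof -
  have "((\<lambda>x. lam * (u 1)\<^sup>2 - (x + y0)\<^sup>2) has_field_derivative - 2 * (u 0 + y0)) (at (u 0))"
    by (auto intro!: derivative_eq_intros)
  then show ?thesis
    using DERIV_chain2[of g D "\<lambda>x. lam * (u 1)\<^sup>2 - (x + y0)\<^sup>2" "u 0"] assms by simp
qed

text \<open>The second equation, split by powers of the coordinate 2, yields \<open>P\<close> and
  then \<open>h\<close>; the first is solved for \<open>Q\<close>, which requires
  \<open>\<kappa> \<noteq> 0\<close>. The third enters through the reduction of the order.\<close>

lemma solve_system:
  fixes lam y0 \<Delta> \<kappa> \<mu> :: real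
  assumes W: "W = jbox c N \<rho>" and c: "c \<in> W" "c 1 \<noteq> 0" "c 0 + y0 \<noteq> 0" and \<Delta>: "\<Delta> \<noteq> 0"
    and h: "smooth_jet_on W h" "depends_on W n h" and P: "smooth_jet_on W P" "depends_on W n P"
    and Q: "smooth_jet_on W Q" "depends_on W n Q" and G: "depends_on W 4 G"
    and h0: "\<And>u. u \<in> W \<Longrightarrow> h u \<noteq> 0"
    and Dh: "\<And>u. u \<in> W \<Longrightarrow> Dx h u = (\<Delta> * (u 0 + y0 - lam * u 2) * P u - \<kappa> * Q u) / \<Delta>"
    and DP: "\<And>u. u \<in> W \<Longrightarrow> Dx P u = - (\<Delta> * (u 0 + y0 - lam * u 2)) * h u"
    and DQ: "\<And>u. u \<in> W \<Longrightarrow> Dx Q u = \<Delta> * G u - \<mu> * h u"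
  obtains V I \<psi> where "open V" "c \<in> V" "V \<subseteq> W" "\<kappa> \<noteq> 0" "open I" "smooth1_on I \<psi>"
    "\<And>t. t \<in> I \<Longrightarrow> deriv \<psi> t \<noteq> 0"
    "\<And>u. u \<in> V \<Longrightarrow> phi_arg lam (transf_jet 1 1 y0 u) \<in> I"
    "\<And>u. u \<in> V \<Longrightarrow> P u = - \<kappa> * \<psi> (phi_arg lam (transf_jet 1 1 y0 u))"
    "\<And>u. u \<in> V \<Longrightarrow> h u = - (\<kappa> / \<Delta>) * (2 * u 1 * deriv \<psi> (phi_arg lam (transf_jet 1 1 y0 u)))"
    "\<And>u. u \<in> V \<Longrightarrow> Q u = flux_Dx lam \<psi> (transf_jet 1 1 y0 u)
        - \<Delta> * (u 0 + y0 - lam * u 2) * \<psi> (phi_arg lam (transf_jet 1 1 y0 u))"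
proof -
  have oW: "open W" by (simp add: W open_jbox)
  have "depends_on W 3 (\<lambda>u. \<Delta> * (u 0 + y0 - lam * u 2))" by (simp add: depends_on_def)
  from order_drop_system[OF W h P Q G this Dh DP DQ]
  have h2: "depends_on W 2 h" and P2: "depends_on W 2 P" by auto
  have "depends_on W 2 (\<lambda>u. - \<Delta> * h u)" by (intro depends_on_intros depends_on_const h2)
  note Psplit = Dx_order_1_split[OF oW P2 this, of y0 lam]
  have P0: "u 1 * pd 0 P u = (u 0 + y0) * (- \<Delta> * h u)" and P1: "pd 1 P u = lam * \<Delta> * h u"
    if "u \<in> W" for u
    using Psplit[OF _ that] DP by (simp_all add: algebra_simps)
  \<comment> \<open>Eliminating \<open>h\<close> from the two parts of the second equation leaves a
    linear first-order equation for \<open>P\<close>.\<close>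
  have PV0: "lam * u 1 * pd 0 P u + (u 0 + y0) * pd 1 P u = 0" if "u \<in> W" for u
    unfolding mult.assoc P0[OF that] P1[OF that] by (simp add: algebra_simps)
  obtain V I T \<phi> where V: "open V" "c \<in> V" "V \<subseteq> W" and I: "open I" and T: "open T" "c 1 \<in> T"
    and phi: "smooth1_on I \<phi>"
    and *: "\<And>u. u \<in> V \<Longrightarrow> lam * (u 1)\<^sup>2 - (u 0 + y0)\<^sup>2 \<in> I \<and> u 0 + y0 \<noteq> 0
        \<and> P u = \<phi> (lam * (u 1)\<^sup>2 - (u 0 + y0)\<^sup>2)"
    and ex: "\<And>t \<tau>. t \<in> I \<Longrightarrow> \<tau> \<in> T \<Longrightarrow> \<exists>u\<in>V. lam * (u 1)\<^sup>2 - (u 0 + y0)\<^sup>2 = t \<and> u 1 = \<tau>"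
    by (rule integrate_phi_arg[OF oW c(1,3) P(1) P2 PV0]) (assumption, rule that)
  define s where "s u = lam * (u 1)\<^sup>2 - (u 0 + y0)\<^sup>2" for u :: jet
  have s: "s u \<in> I" "u 0 + y0 \<noteq> 0" "P u = \<phi> (s u)" if "u \<in> V" for u
    using *[OF that] by (simp_all add: s_def)
  \<comment> \<open>Inserting \<open>P = \<phi> (s u)\<close> into the first part gives a common
    factor \<open>u 0 + y0\<close>, which is nonzero on \<open>V\<close> and cancels.\<close>
  have hV: "h u = 2 * u 1 * deriv \<phi> (s u) / \<Delta>" if u: "u \<in> V" for u
  proof -
    have "has_pd (\<lambda>u. \<phi> (s u)) 0 (deriv \<phi> (s u) * (- 2 * (u 0 + y0))) u"
      unfolding s_def by (rule has_pd_comp_phi_arg) (use smooth1_imp_DERIV[OF phi s(1)[OF u]] in \<open>simp add: s_def\<close>)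
    then have "pd 0 P u = deriv \<phi> (s u) * (- 2 * (u 0 + y0))"
      using has_pd_imp_pd has_pd_cong[OF V(1) u, of "\<lambda>u. \<phi> (s u)" P] s(3) by simp
    then have "u 1 * (deriv \<phi> (s u) * (- 2 * (u 0 + y0))) = (u 0 + y0) * (- \<Delta> * h u)"
      using P0[OF subsetD[OF V(3) u]] by simp
    then have "(u 0 + y0) * (2 * u 1 * deriv \<phi> (s u)) = (u 0 + y0) * (\<Delta> * h u)"
      by (simp add: algebra_simps)
    then have "2 * u 1 * deriv \<phi> (s u) = \<Delta> * h u" 
      by (rule iffD1[OF mult_left_cancel[OF s(2)[OF u]]])
    then show ?thesis using \<Delta> by (simp add: field_simps)
  qed
  \<comment> \<open>Every level \<open>t\<close> is attained in \<open>V\<close>, where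
    \<open>h\<close> does not vanish.\<close>
  have dphi: "deriv \<phi> t \<noteq> 0" if "t \<in> I" for t
    using ex[OF that T(2)] hV h0 V(3) unfolding s_def[symmetric] by fastforce
  \<comment> \<open>If \<open>\<kappa> = 0\<close>, then \<open>- 4 z\<^sub>1\<^sup>2 \<phi>'' = \<Delta> \<phi>\<close> at fixed argument of \<open>\<phi>\<close>, where \<open>z\<^sub>1\<close> still varies.\<close>
  have \<kappa>: "\<kappa> \<noteq> 0"
  proof
    assume "\<kappa> = 0"
    then have "Dx h u = (u 0 + y0 - lam * u 2) * P u" if "u \<in> W" for u
      using Dh[OF that] \<Delta> by simp
    note hsplit = Dx_order_1_split(1)[OF oW h2 P2 this]
    have key: "- 4 * (u 1)\<^sup>2 * deriv (deriv \<phi>) (s u) = \<Delta> * \<phi> (s u)" if u: "u \<in> V" for u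
    proof -
      have "has_pd (\<lambda>u. deriv \<phi> (s u)) 0 (deriv (deriv \<phi>) (s u) * (- 2 * (u 0 + y0))) u"
        unfolding s_def
        by (rule has_pd_comp_phi_arg)
          (use smooth1_imp_DERIV[OF smooth1_deriv[OF phi] s(1)[OF u]] in \<open>simp add: s_def\<close>)
      from DERIV_cmult[OF this, of "2 * u 1 / \<Delta>"]
      have "has_pd (\<lambda>w. 2 * w 1 * deriv \<phi> (s w) / \<Delta>) 0
         (2 * u 1 / \<Delta> * (deriv (deriv \<phi>) (s u) * (- 2 * (u 0 + y0)))) u"
        by simp
      then have "pd 0 h u = 2 * u 1 / \<Delta> * (deriv (deriv \<phi>) (s u) * (- 2 * (u 0 + y0)))"
        using has_pd_imp_pd has_pd_cong[OF V(1) u, of "\<lambda>w. 2 * w 1 * deriv \<phi> (s w) / \<Delta>" h] hV by simp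
      moreover have "u 1 * pd 0 h u = (u 0 + y0) * \<phi> (s u)"
        using hsplit[of u] s(3)[OF u] V(3) u by auto
      ultimately have e: "u 1 * (2 * u 1 / \<Delta> * (deriv (deriv \<phi>) (s u) * (- 2 * (u 0 + y0))))
          = (u 0 + y0) * \<phi> (s u)" by simp
      have "(u 0 + y0) * (- 4 * (u 1)\<^sup>2 * deriv (deriv \<phi>) (s u))
          = \<Delta> * (u 1 * (2 * u 1 / \<Delta> * (deriv (deriv \<phi>) (s u) * (- 2 * (u 0 + y0)))))"
        using \<Delta> by (simp add: field_simps power2_eq_square)
      also have "\<dots> = (u 0 + y0) * (\<Delta> * \<phi> (s u))" unfolding e by simp
      finally have "(u 0 + y0) * (- 4 * (u 1)\<^sup>2 * deriv (deriv \<phi>) (s u)) = (u 0 + y0) * (\<Delta> * \<phi> (s u))" .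
      then show ?thesis by (rule iffD1[OF mult_left_cancel[OF s(2)[OF u]]])
    qed
    \<comment> \<open>Two parameters with different squares on the same level force
      \<open>\<phi>''\<close> and hence \<phi> to vanish there, against
      \<open>\<phi>' \<noteq> 0\<close>.\<close>
    have "infinite T" using T finite_imp_not_open by blast
    then have "\<not> T \<subseteq> {c 1, - c 1}" using finite_subset by blast
    then obtain \<tau> where \<tau>': "\<tau> \<in> T" "\<tau> \<notin> {c 1, - c 1}" by blast
    then have \<tau>: "\<tau> \<in> T" "\<tau>\<^sup>2 \<noteq> (c 1)\<^sup>2" by (simp_all add: power2_eq_iff)
    have phi0: "\<phi> t = 0" if t: "t \<in> I" for t
    proof -
      have ev: "- 4 * \<tau>\<^sup>2 * deriv (deriv \<phi>) t = \<Delta> * \<phi> t" if \<tau>: "\<tau> \<in> T" for \<tau>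
      proof -
        obtain u where "u \<in> V" "s u = t" "u 1 = \<tau>" using ex[OF t \<tau>] by (auto simp: s_def)
        then show ?thesis using key[of u] by simp
      qed
      have "(\<tau>\<^sup>2 - (c 1)\<^sup>2) * deriv (deriv \<phi>) t = 0"
        using ev[OF \<tau>(1)] ev[OF T(2)] unfolding left_diff_distrib by linarith
      then have "deriv (deriv \<phi>) t = 0" using \<tau>(2) by simp
      then show ?thesis using ev[OF \<tau>(1)] \<Delta> by simp
    qed
    have "((\<lambda>_. 0) has_field_derivative deriv \<phi> (s c)) (at (s c))"
      using smooth1_imp_DERIV[OF phi s(1)[OF V(2)]] I s(1)[OF V(2)] phi0
      by (rule has_field_derivative_transform_within_open)
    then have "deriv \<phi> (s c) = 0" by (rule DERIV_unique[OF _ DERIV_const])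
    then show False using dphi[OF s(1)[OF V(2)]] by simp
  qed
  \<comment> \<open>The rescaling gives \<open>P = - \<kappa> * \<psi>\<close>, as the normal form
    demands.\<close>
  define \<psi> where "\<psi> t = (- 1 / \<kappa>) * \<phi> t" for t
  have dpsi: "deriv \<psi> t = - deriv \<phi> t / \<kappa>" if "t \<in> I" for t
    using DERIV_imp_deriv[OF DERIV_cmult[OF smooth1_imp_DERIV[OF phi that], of "- 1 / \<kappa>"]]
    by (simp add: \<psi>_def [abs_def])
  have oI: "open {w::jet. w 0 \<in> I}"
    using open_vimage[OF I continuous_on_coordinate[of UNIV 0]] by (simp add: vimage_def)
  have "smooth_gen {w. w 0 \<in> I} (\<lambda>w. \<psi> (w 0))"
    unfolding \<psi>_def
    by (intro smooth_gen_intros smooth_gen.base phi[unfolded smooth1_on_def])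
  then have psi: "smooth1_on I \<psi>"
    unfolding smooth1_on_def by (rule smooth_gen_imp_smooth[OF oI])
  define Tr where "Tr = transf_jet 1 1 y0"
  have arg: "phi_arg lam (Tr u) = s u" for u by (simp add: Tr_def phi_arg_transf_jet s_def)
  have PV: "P u = - \<kappa> * \<psi> (s u)" if "u \<in> V" for u
    using s(3)[OF that] \<kappa> by (simp add: \<psi>_def)
  have hV': "h u = - (\<kappa> / \<Delta>) * (2 * u 1 * deriv \<psi> (s u))" if "u \<in> V" for u
    using hV[OF that] dpsi[OF s(1)[OF that]] \<kappa> by simp
  \<comment> \<open>Differentiating the formula for \<open>h\<close> and comparing with the first
    equation expresses \<open>Q\<close>.\<close>
  have QV: "Q u = flux_Dx lam \<psi> (Tr u) - \<Delta> * (u 0 + y0 - lam * u 2) * \<psi> (s u)"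
    if u: "u \<in> V" for u
  proof -
    have "has_td (\<lambda>w. - (\<kappa> / \<Delta>) * (2 * Tr w 1 * deriv \<psi> (phi_arg lam (Tr w)))) u (shift u)
        (- (\<kappa> / \<Delta>) * (1 * flux_Dx lam \<psi> (Tr u)))"
      unfolding Tr_def
      by (intro has_td_cmult has_td_transf_jet has_td_flux[OF psi])
        (use s(1)[OF u] arg in \<open>simp_all add: Tr_def\<close>)
    then have "has_td h u (shift u) (- (\<kappa> / \<Delta>) * (1 * flux_Dx lam \<psi> (Tr u)))"
      by (rule has_td_cong[OF V(1) u, rotated]) (simp add: hV' arg, simp add: Tr_def transf_jet_def)
    then have "(\<Delta> * (u 0 + y0 - lam * u 2) * P u - \<kappa> * Q u) / \<Delta> = - (\<kappa> / \<Delta>) * flux_Dx lam \<psi> (Tr u)"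
      using has_td_imp_Dx[of h u] Dh[of u] V(3) u by auto
    moreover have "a = - \<kappa> * x" if "a / \<Delta> = - (\<kappa> / \<Delta>) * x" for a x
      using that \<Delta> by (simp add: field_simps)
    ultimately have "\<Delta> * (u 0 + y0 - lam * u 2) * P u - \<kappa> * Q u = - \<kappa> * flux_Dx lam \<psi> (Tr u)"
      by blast
    then have "\<kappa> * Q u = \<kappa> * (flux_Dx lam \<psi> (Tr u) - \<Delta> * (u 0 + y0 - lam * u 2) * \<psi> (s u))"
      by (simp add: PV[OF u] algebra_simps)
    then show ?thesis using \<kappa> by simp
  qed
  show thesis
  proof (rule that[OF V \<kappa> I psi])
    show "deriv \<psi> t \<noteq> 0" if "t \<in> I" for t using dpsi[OF that] dphi[OF that] \<kappa> by simp
  qed (use s(1) PV hV' QV arg in \<open>simp_all add: Tr_def\<close>)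
qed

text \<open>Linear combinations decouple the system for \<open>solve_system\<close>; its solution is
  then matched with the normal form after translating \<open>z\<close> by \<open>y0\<close>.\<close>

lemma describes_imp_normal_form:
  fixes \<delta> lam :: real
  assumes V: "open V" "V \<noteq> {}" and desc: "describes \<delta> (eqn lam A B) f V"
    and adm: "admissible \<delta> 0 f V"
  obtains V' c0 I \<phi> r \<gamma> \<sigma> \<epsilon> where "open V'" "V' \<noteq> {}" "V' \<subseteq> V" "\<gamma> + \<delta> * \<sigma>\<^sup>2 \<ge> 0"
    "\<epsilon> = 1 \<or> \<epsilon> = -1"
    "normal_form_on \<delta> lam (rhs A B) 1 1 1 c0 I \<phi> r \<gamma> V'"
    "normal_one_forms_on \<delta> lam f 1 1 1 c0 \<phi> r \<gamma> \<sigma> \<epsilon> V'"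
proof -
  obtain p p' k where f21': "\<And>u. u \<in> V \<Longrightarrow> f 2 1 u = p * u 0 + p' * u 2 + k"
    using adm unfolding admissible_def affine_in_z_z2_def by blast
  obtain q q' l where f31': "\<And>u. u \<in> V \<Longrightarrow> f 3 1 u = q * u 0 + q' * u 2 + l"
    using adm unfolding admissible_def affine_in_z_z2_def by blast
  have f11: "f 1 1 u = 0" if "u \<in> V" for u using adm that unfolding admissible_def by blast
  note sys' = describes_imp_system[OF V desc f11 f21' f31', simplified]
  have sys: "p' = - lam * p" "q' = - lam * q"
    "\<And>u. u \<in> V \<Longrightarrow> Dx (f 1 2) u = wedge f 3 2 u"
    "\<And>u. u \<in> V \<Longrightarrow> Dx (f 2 2) u = p * rhs A B u - f 1 2 u * f 3 1 u"
    "\<And>u. u \<in> V \<Longrightarrow> Dx (f 3 2) u = q * rhs A B u - \<delta> * f 1 2 u * f 2 1 u"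
    using sys' by simp_all
  have f21: "f 2 1 u = p * (u 0 - lam * u 2) + k" and f31: "f 3 1 u = q * (u 0 - lam * u 2) + l"
    if "u \<in> V" for u
    using f21'[OF that] f31'[OF that] sys(1,2) by (simp_all add: algebra_simps)
  \<comment> \<open>\<Delta> is the determinant of the passage from \<open>f 2 2\<close>,
    \<open>f 3 2\<close> to \<open>P\<close>, \<open>Q\<close> below.\<close>
  define \<Delta> where "\<Delta> = q\<^sup>2 - \<delta> * p\<^sup>2"
  define e where "e = q * l - \<delta> * p * k"
  define \<kappa> where "\<kappa> = q * k - p * l"
  obtain u0 where u0: "u0 \<in> V" using V(2) by blast
  have pd0: "pd 0 g u0 = p" if "\<And>u. u \<in> V \<Longrightarrow> g u = p * (u 0 - lam * u 2) + k" for g p k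
  proof -
    have "has_pd (\<lambda>u. p * (u 0 - lam * u 2) + k) 0 p u0"
      by (auto intro!: derivative_eq_intros)
    then show ?thesis
      using has_pd_imp_pd has_pd_cong[OF V(1) u0, of "\<lambda>u. p * (u 0 - lam * u 2) + k" g] that by simp
  qed
  have \<Delta>: "\<Delta> \<noteq> 0"
    using adm u0 pd0[OF f21] pd0[OF f31] unfolding admissible_def \<Delta>_def by auto
  define y0 where "y0 = e / \<Delta>"
  obtain s where s: "u0(1 := s) \<in> V" "s \<notin> {0}"
    using open_jet_avoid[OF V(1) u0, of "{0}" 1] by blast
  \<comment> \<open>The centre leaves \<open>z + y0 = 0\<close>, where the two branches of the
    square root meet.\<close>
  obtain s' where s': "u0(1 := s, 0 := s') \<in> V" "s' \<notin> {- y0}"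
    using open_jet_avoid[OF V(1) s(1), of "{- y0}" 0] by blast
  define c where "c = u0(1 := s, 0 := s')"
  have c: "c \<in> V" "c 1 \<noteq> 0" "c 0 + y0 \<noteq> 0" using s s' by (auto simp: c_def)
  obtain N \<rho> where N: "\<rho> > 0" "\<And>v. (\<And>i. i < N \<Longrightarrow> \<bar>v i - c i\<bar> < \<rho>) \<Longrightarrow> v \<in> V"
    using open_jets_contains_box[OF V(1) c(1)] by blast
  define W where "W = jbox c N \<rho>"
  have WV: "W \<subseteq> V" using N(2) by (auto simp: W_def jbox_def)
  have cW: "c \<in> W" using N(1) by (simp add: W_def jbox_def)
  have oW: "open W" by (simp add: W_def open_jbox)
  have df: "smooth_jet_on W (f i j)" "\<exists>n. depends_on W n (f i j)"
    if "i \<in> {1,2,3}" "j \<in> {1,2}" for i j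
  proof -
    have "differential_function_on V (f i j)" using desc that unfolding describes_def by blast
    then show "smooth_jet_on W (f i j)" "\<exists>n. depends_on W n (f i j)"
      using smooth_subset[OF _ WV] depends_on_subset[OF _ WV]
      unfolding differential_function_on_iff by blast+
  qed
  obtain n1 n2 n3 where n: "depends_on W n1 (f 1 2)" "depends_on W n2 (f 2 2)" "depends_on W n3 (f 3 2)"
    using df(2)[of 1 2] df(2)[of 2 2] df(2)[of 3 2] by auto
  define n where "n = n1 + n2 + n3"
  have d: "depends_on W n (f 1 2)" "depends_on W n (f 2 2)" "depends_on W n (f 3 2)"
    using n[THEN depends_on_mono] by (simp_all add: n_def)
  have sm: "smooth_jet_on W (f 1 2)" "smooth_jet_on W (f 2 2)" "smooth_jet_on W (f 3 2)"
    using df(1) by simp_all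
  \<comment> \<open>\<open>P\<close> is the combination whose derivative is free of
    \<open>rhs\<close>; in that of \<open>Q\<close> the right-hand side has coefficient
    \<Delta>.\<close>
  define P where "P = (\<lambda>u. q * f 2 2 u - p * f 3 2 u)"
  define Q where "Q = (\<lambda>u. q * f 3 2 u - \<delta> * p * f 2 2 u)"
  have sP: "smooth_jet_on W P" and sQ: "smooth_jet_on W Q"
    unfolding P_def Q_def
    by (rule smooth_gen_imp_smooth[OF oW], intro smooth_gen_intros smooth_gen.base sm)+
  have dP: "depends_on W n P" and dQ: "depends_on W n Q"
    unfolding P_def Q_def by (intro depends_on_intros depends_on_const d)+
  have dG: "depends_on W 4 (rhs A B)" by (simp add: depends_on_def rhs_def)
  have w12: "f 1 2 u * f 2 1 u \<noteq> 0" if "u \<in> V" for u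
    using desc f11[OF that] that unfolding describes_def by (auto simp: wedge_def)
  have M: "\<Delta> * (u 0 + y0 - lam * u 2) = \<Delta> * (u 0 - lam * u 2) + e" for u :: jet
    using \<Delta> by (simp add: y0_def algebra_simps)
  have Dx2: "has_td (f 2 2) u (shift u) (p * rhs A B u - f 1 2 u * f 3 1 u)"
    and Dx3: "has_td (f 3 2) u (shift u) (q * rhs A B u - \<delta> * f 1 2 u * f 2 1 u)" if "u \<in> W" for u
    using smooth_has_Dx[OF oW d(2) sm(2) that] smooth_has_Dx[OF oW d(3) sm(3) that]
      sys(4)[OF subsetD[OF WV that]] sys(5)[OF subsetD[OF WV that]] by simp_all
  have Dh: "Dx (f 1 2) u = (\<Delta> * (u 0 + y0 - lam * u 2) * P u - \<kappa> * Q u) / \<Delta>" if "u \<in> W" for u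
  proof -
    have "\<Delta> * wedge f 3 2 u = \<Delta> * (u 0 + y0 - lam * u 2) * P u - \<kappa> * Q u"
      unfolding M wedge_def f21[OF subsetD[OF WV that]] f31[OF subsetD[OF WV that]]
      unfolding P_def Q_def \<Delta>_def \<kappa>_def e_def by algebra
    then show ?thesis using sys(3)[OF subsetD[OF WV that]] \<Delta> by (simp add: field_simps)
  qed
  have DP: "Dx P u = - (\<Delta> * (u 0 + y0 - lam * u 2)) * f 1 2 u" if u: "u \<in> W" for u
  proof -
    have "Dx P u = q * (p * rhs A B u - f 1 2 u * f 3 1 u) - p * (q * rhs A B u - \<delta> * f 1 2 u * f 2 1 u)"
      unfolding P_def by (intro has_td_imp_Dx has_td_diff has_td_cmult Dx2 Dx3 u)
    then show ?thesis
      unfolding M f21[OF subsetD[OF WV that]] f31[OF subsetD[OF WV that]]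
      unfolding \<Delta>_def e_def by algebra
  qed
  have DQ: "Dx Q u = \<Delta> * rhs A B u - (\<delta> * \<kappa>) * f 1 2 u" if u: "u \<in> W" for u
  proof -
    have "Dx Q u = q * (q * rhs A B u - \<delta> * f 1 2 u * f 2 1 u) - \<delta> * p * (p * rhs A B u - f 1 2 u * f 3 1 u)"
      unfolding Q_def by (intro has_td_imp_Dx has_td_diff has_td_cmult Dx2 Dx3 u)
    then show ?thesis
      unfolding f21[OF subsetD[OF WV that]] f31[OF subsetD[OF WV that]]
      unfolding \<Delta>_def \<kappa>_def by algebra
  qed
  have h0: "f 1 2 u \<noteq> 0" if "u \<in> W" for u using w12[of u] WV that by auto
  obtain V' I \<psi> where V': "open V'" "c \<in> V'" "V' \<subseteq> W" and \<kappa>: "\<kappa> \<noteq> 0"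
    and I: "open I" "smooth1_on I \<psi>" and dpsi: "\<And>t. t \<in> I \<Longrightarrow> deriv \<psi> t \<noteq> 0"
    and arg': "\<And>u. u \<in> V' \<Longrightarrow> phi_arg lam (transf_jet 1 1 y0 u) \<in> I"
    and PV': "\<And>u. u \<in> V' \<Longrightarrow> P u = - \<kappa> * \<psi> (phi_arg lam (transf_jet 1 1 y0 u))"
    and hV': "\<And>u. u \<in> V' \<Longrightarrow> f 1 2 u = - (\<kappa> / \<Delta>) * (2 * u 1 * deriv \<psi> (phi_arg lam (transf_jet 1 1 y0 u)))"
    and QV': "\<And>u. u \<in> V' \<Longrightarrow> Q u = flux_Dx lam \<psi> (transf_jet 1 1 y0 u)
        - \<Delta> * (u 0 + y0 - lam * u 2) * \<psi> (phi_arg lam (transf_jet 1 1 y0 u))"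
    by (rule solve_system[OF W_def cW c(2,3) \<Delta> sm(1) d(1) sP dP sQ dQ dG h0 Dh DP DQ])
      (assumption, assumption, assumption, assumption, rule that)
  define T where "T = transf_jet 1 1 y0"
  note arg = arg'[folded T_def] and PV = PV'[folded T_def] and hV = hV'[folded T_def]
    and QV = QV'[folded T_def]
  have V'V: "u \<in> V" if "u \<in> V'" for u using that V'(3) WV by blast
  \<comment> \<open>The constants are forced by comparison: the discriminant is
    \<open>1 / \<gamma>\<close>, \<open>f 2 1\<close> has slope \<sigma>/\<gamma>, and
    \<open>f 1 2\<close> has factor \<open>- r\<close>.\<close>
  define \<gamma> where "\<gamma> = 1 / \<Delta>"
  define \<sigma> where "\<sigma> = p / \<Delta>"
  define r where "r = \<kappa> / \<Delta>"
  \<comment> \<open>\<epsilon> is the sign of \<open>q / \<Delta>\<close>, because the root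
    \<open>R\<close> gives only its absolute value.\<close>
  define \<epsilon> :: real where "\<epsilon> = (if q / \<Delta> \<ge> 0 then 1 else - 1)"
  define R where "R = sqrt (\<gamma> + \<delta> * \<sigma>\<^sup>2)"
  have eps: "\<epsilon> = 1 \<or> \<epsilon> = - 1" "\<epsilon>\<^sup>2 = 1" by (simp_all add: \<epsilon>_def)
  have "\<gamma> + \<delta> * \<sigma>\<^sup>2 = (\<Delta> + \<delta> * p\<^sup>2) / \<Delta>\<^sup>2"
    using \<Delta> by (simp add: \<gamma>_def \<sigma>_def field_simps power2_eq_square)
  also have "\<dots> = (q / \<Delta>)\<^sup>2" by (simp add: \<Delta>_def power_divide)
  finally have R2: "\<gamma> + \<delta> * \<sigma>\<^sup>2 = (q / \<Delta>)\<^sup>2" .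
  have "R = \<bar>q / \<Delta>\<bar>" unfolding R_def R2 by (rule real_sqrt_abs)
  also have "\<dots> = \<epsilon> * (q / \<Delta>)" unfolding \<epsilon>_def abs_if by (cases "q / \<Delta> \<ge> 0") simp_all
  finally have R: "R = \<epsilon> * (q / \<Delta>)" .
  have eR: "\<epsilon> * R = q / \<Delta>" using eps(2) by (simp add: R power2_eq_square mult.assoc [symmetric])
  have \<gamma>: "\<gamma> \<noteq> 0" using \<Delta> by (simp add: \<gamma>_def)
  \<comment> \<open>This inverts the linear definitions of \<open>e\<close> and \<kappa>, recovering
    \<open>k\<close> and \<open>l\<close>.\<close>
  have kl: "p * y0 + q * \<kappa> / \<Delta> = k" "q * y0 + \<delta> * p * \<kappa> / \<Delta> = l"
  proof -
    have "p * e + q * \<kappa> = k * \<Delta>" "q * e + \<delta> * p * \<kappa> = l * \<Delta>"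
      unfolding e_def \<kappa>_def \<Delta>_def by algebra+
    then show "p * y0 + q * \<kappa> / \<Delta> = k" "q * y0 + \<delta> * p * \<kappa> / \<Delta> = l"
      using \<Delta> by (simp_all add: y0_def field_simps)
  qed
  define F where "F = normal_f \<delta> lam \<psi> r \<gamma> \<sigma> \<epsilon>"
  have T: "T u 0 = u 0 + y0" "T u 1 = u 1" "T u 2 = u 2" for u
    by (simp_all add: T_def transf_jet_def)
  note Fs = normal_f_simps[OF I(2) arg, of _ \<delta> r \<gamma> \<sigma> \<epsilon>, folded F_def R_def]
  have F1: "f i 1 u = F i 1 (T u)" "f i 2 u = F i 2 (T u)" if u: "u \<in> V'" and i: "i \<in> {1,2,3}" for i u
  proof -
    note uV = V'V[OF u]
    have F21: "F 2 1 (T u) = f 2 1 u"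
    proof -
      have "F 2 1 (T u) = p * (u 0 + y0 - lam * u 2) + r * (\<epsilon> * R) / \<gamma>"
        using Fs(3)[OF u] \<Delta> unfolding T by (simp add: \<sigma>_def \<gamma>_def)
      also have "\<dots> = p * (u 0 - lam * u 2) + (p * y0 + q * \<kappa> / \<Delta>)"
        unfolding eR r_def \<gamma>_def using \<Delta> by (simp add: algebra_simps)
      finally show ?thesis using f21[OF uV] kl(1) by simp
    qed
    have F31: "F 3 1 (T u) = f 3 1 u"
    proof -
      have "F 3 1 (T u) = (\<epsilon> * R) / \<gamma> * (u 0 + y0 - lam * u 2) + \<delta> * \<sigma> * r / \<gamma>"
        using Fs(5)[OF u] unfolding T eps(2) by simp
      also have "\<dots> = q * (u 0 - lam * u 2) + (q * y0 + \<delta> * p * \<kappa> / \<Delta>)"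
        unfolding eR r_def \<gamma>_def \<sigma>_def using \<Delta> by (simp add: algebra_simps)
      finally show ?thesis using f31[OF uV] kl(2) by simp
    qed
    have F12: "F 1 2 (T u) = f 1 2 u"
      using Fs(2)[OF u] hV[OF u] unfolding T by (simp add: r_def)
    define X where "X = flux_Dx lam \<psi> (T u)"
    define y where "y = \<psi> (phi_arg lam (T u))"
    have Pu: "q * f 2 2 u - p * f 3 2 u = - \<kappa> * y"
      using PV[OF u] by (simp add: P_def y_def)
    have Qu: "q * f 3 2 u - \<delta> * p * f 2 2 u = X - (\<Delta> * (u 0 - lam * u 2) + e) * y"
      using QV[OF u] unfolding M by (simp add: Q_def X_def y_def)
    have F22: "F 2 2 (T u) = f 2 2 u"
    proof -
      \<comment> \<open>Cramer's rule for \<open>Pu\<close> and \<open>Qu\<close>.\<close>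
      have "\<Delta> * f 2 2 u = p * X - (p * (u 0 - lam * u 2) + k) * y * \<Delta>"
        using Pu Qu unfolding \<Delta>_def e_def \<kappa>_def by algebra
      then have "f 2 2 u = p / \<Delta> * X - (p * (u 0 - lam * u 2) + k) * y"
        using \<Delta> by (simp add: field_simps)
      then show ?thesis using Fs(4)[OF u] F21 f21[OF uV] by (simp add: \<sigma>_def X_def y_def)
    qed
    have F32: "F 3 2 (T u) = f 3 2 u"
    proof -
      have "\<Delta> * f 3 2 u = q * X - (q * (u 0 - lam * u 2) + l) * y * \<Delta>"
        using Pu Qu unfolding \<Delta>_def e_def \<kappa>_def by algebra
      then have "f 3 2 u = q / \<Delta> * X - (q * (u 0 - lam * u 2) + l) * y"
        using \<Delta> by (simp add: field_simps)
      then show ?thesis using Fs(6)[OF u] F31 f31[OF uV] eR by (simp add: X_def y_def)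
    qed
    show "f i 1 u = F i 1 (T u)" "f i 2 u = F i 2 (T u)"
      using i F21 F31 F12 F22 F32 Fs(1)[OF u] f11[OF uV] by auto
  qed
  have R0: "\<gamma> + \<delta> * \<sigma>\<^sup>2 \<ge> 0" by (simp add: R2)
  note NS = normal_structure[where r = r, OF I arg \<gamma> R0 eps(1), folded F_def R_def]
  have pq: "p \<noteq> 0 \<or> q \<noteq> 0" using \<Delta> by (auto simp: \<Delta>_def)
  \<comment> \<open>The same forms satisfy the equations for both right-hand sides, so their
    difference is annihilated by \<open>p\<close> and by \<open>q\<close>, which are not both
    zero.\<close>
  have G: "rhs A B u = normal_rhs \<delta> lam \<psi> r \<gamma> (T u)" if u: "u \<in> V'" for u
  proof -
    have w: "wedge F i j (T u) = wedge f i j u" if "i \<in> {1,2,3}" "j \<in> {1,2,3}" for i j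
      using F1[OF u that(1)] F1[OF u that(2)] by (simp add: wedge_def)
    have td: "Dx (f i 2) u = d" if "has_td (F i 2) (T u) (shift (T u)) d" "i \<in> {1,2,3}" for i d
    proof -
      have "has_td (\<lambda>w. F i 2 (T w)) u (shift u) (1 * d)"
        using has_td_transf_jet[OF that(1)[unfolded T_def]] by (simp add: T_def)
      then have "has_td (f i 2) u (shift u) (1 * d)"
        by (rule has_td_cong[OF V'(1) u, rotated]) (simp add: F1(2)[OF _ that(2)])
      then show ?thesis using has_td_imp_Dx by simp
    qed
    have "p * normal_rhs \<delta> lam \<psi> r \<gamma> (T u) = p * rhs A B u"
      using td[OF NS(2)[OF u]] sys(4)[OF V'V[OF u]] w[of 1 3] f11[OF V'V[OF u]] \<Delta>
      by (auto simp: \<sigma>_def \<gamma>_def wedge_def)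
    moreover have "q * normal_rhs \<delta> lam \<psi> r \<gamma> (T u) = q * rhs A B u"
      using td[OF NS(3)[OF u]] sys(5)[OF V'V[OF u]] w[of 1 2] f11[OF V'V[OF u]] \<Delta>
      by (auto simp: eR \<gamma>_def wedge_def)
    ultimately show ?thesis using pq by auto
  qed
  show thesis
  proof (rule that)
    show "open V'" "V' \<noteq> {}" "V' \<subseteq> V" using V' WV by blast+
    show "normal_form_on \<delta> lam (rhs A B) 1 1 1 y0 I \<psi> r \<gamma> V'"
      using \<gamma> \<kappa> \<Delta> I dpsi arg G by (simp add: normal_form_on_def r_def T_def)
    show "normal_one_forms_on \<delta> lam f 1 1 1 y0 \<psi> r \<gamma> \<sigma> \<epsilon> V'"
      using F1 by (simp add: normal_one_forms_on_def F_def T_def)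
  qed (use R0 eps in auto)
qed

theorem theorem3p2:
  fixes lam \<delta> :: real
    and A B :: "real \<Rightarrow> real \<Rightarrow> real \<Rightarrow> real"
    and D :: "(real \<times> real \<times> real) set"
  assumes "\<delta> = 1 \<or> \<delta> = -1"
    and "open D" and "D \<noteq> {}"
    and "smooth3_on D A" and "smooth3_on D B"
    and "\<forall>(p, q, s)\<in>D. (A p q s)\<^sup>2 + (B p q s)\<^sup>2 \<noteq> 0"
  shows
    "((\<exists>f V. open V \<and> V \<noteq> {} \<and> V \<subseteq> jets_over D \<and>
         describes \<delta> (eqn lam A B) f V \<and> admissible \<delta> 0 f V)
      \<longleftrightarrow>
      (\<exists>V a b c c0 I \<phi> r \<gamma> \<sigma>. open V \<and> V \<noteq> {} \<and> V \<subseteq> jets_over D \<and>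
         \<gamma> + \<delta> * \<sigma>\<^sup>2 \<ge> 0 \<and>
         normal_form_on \<delta> lam (rhs A B) a b c c0 I \<phi> r \<gamma> V))
     \<and>
     (\<forall>f.
      (\<exists>V. open V \<and> V \<noteq> {} \<and> V \<subseteq> jets_over D \<and>
         describes \<delta> (eqn lam A B) f V \<and> admissible \<delta> 0 f V)
      \<longleftrightarrow>
      (\<exists>V a b c c0 I \<phi> r \<gamma> \<sigma> \<epsilon>. open V \<and> V \<noteq> {} \<and> V \<subseteq> jets_over D \<and>
         \<gamma> + \<delta> * \<sigma>\<^sup>2 \<ge> 0 \<and> (\<epsilon> = 1 \<or> \<epsilon> = -1) \<and>
         normal_form_on \<delta> lam (rhs A B) a b c c0 I \<phi> r \<gamma> V \<and>
         normal_one_forms_on \<delta> lam f a b c c0 \<phi> r \<gamma> \<sigma> \<epsilon> V))"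
    (is "(?L1 \<longleftrightarrow> ?R1) \<and> (\<forall>f. ?L f \<longleftrightarrow> ?R f)")
proof -
  have forward: "?R f" if L: "?L f" for f
  proof -
    obtain V where V: "open V" "V \<noteq> {}" "V \<subseteq> jets_over D"
      "describes \<delta> (eqn lam A B) f V" "admissible \<delta> 0 f V"
      using L by blast
    obtain V' c0 I \<phi> r \<gamma> \<sigma> \<epsilon> where "open V'" "V' \<noteq> {}" "V' \<subseteq> V" "\<gamma> + \<delta> * \<sigma>\<^sup>2 \<ge> 0"
      "\<epsilon> = 1 \<or> \<epsilon> = -1"
      "normal_form_on \<delta> lam (rhs A B) 1 1 1 c0 I \<phi> r \<gamma> V'"
      "normal_one_forms_on \<delta> lam f 1 1 1 c0 \<phi> r \<gamma> \<sigma> \<epsilon> V'"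
      by (rule describes_imp_normal_form[OF V(1,2,4,5)])
    moreover from this have "V' \<subseteq> jets_over D" using V(3) by blast
    ultimately show ?thesis by blast
  qed
  have backward: "?L f" if R: "?R f" for f
  proof -
    obtain V a b c c0 I \<phi> r \<gamma> \<sigma> \<epsilon> where V: "open V" "V \<noteq> {}" "V \<subseteq> jets_over D"
      "\<gamma> + \<delta> * \<sigma>\<^sup>2 \<ge> 0" "\<epsilon> = 1 \<or> \<epsilon> = -1"
      "normal_form_on \<delta> lam (rhs A B) a b c c0 I \<phi> r \<gamma> V"
      "normal_one_forms_on \<delta> lam f a b c c0 \<phi> r \<gamma> \<sigma> \<epsilon> V"
      using R by blast
    obtain V' where "open V'" "V' \<noteq> {}" "V' \<subseteq> V" "describes \<delta> (eqn lam A B) f V'"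
      "admissible \<delta> 0 f V'"
      by (rule normal_form_imp_describes[OF V(1,2,6,7,4,5), of "eqn lam A B"]) (auto simp: eqn_def)
    moreover from this have "V' \<subseteq> jets_over D" using V(3) by blast
    ultimately show ?thesis by blast
  qed
  have backward1: "?L1" if R: "?R1"
  proof -
    obtain V a b c c0 I \<phi> r \<gamma> \<sigma> where V: "open V" "V \<noteq> {}" "V \<subseteq> jets_over D"
      "\<gamma> + \<delta> * \<sigma>\<^sup>2 \<ge> 0" "normal_form_on \<delta> lam (rhs A B) a b c c0 I \<phi> r \<gamma> V"
      using R by blast
    \<comment> \<open>Forms are manufactured from the normal form itself; the sign is free and taken
      to be 1. The statement for given forms then applies.\<close>
    define f where "f i j u = (if j = (1::nat) then a else b) *
      normal_f \<delta> (a\<^sup>2 * lam) \<phi> r \<gamma> \<sigma> 1 i j (transf_jet a c c0 u)" for i j u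
    have "normal_one_forms_on \<delta> lam f a b c c0 \<phi> r \<gamma> \<sigma> 1 V"
      by (simp add: normal_one_forms_on_def f_def)
    with V have "?R f" by blast
    from backward[OF this] show ?thesis by blast
  qed
  have forward1: "?R1" if L: "?L1"
  proof -
    obtain f where "?L f" using L ..
    from forward[OF this] show ?thesis by blast
  qed
  show ?thesis
    by (intro conjI allI iffI) (fact forward1, fact backward1, fact forward, fact backward)
qed

end
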